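(* Let $\alpha\in[2,3)$ and let $$U_\alpha[0,1]^2=\{f\in C_\alpha[0,1]^2:\dim_{\mathrm B}G_f=\alpha\text{ and }\alpha-1\le\underline{\dim}_{\mathrm B}G_{H(f)}\le\overline{\dim}_{\mathrm B}G_{H(f)}<2\}$$ and $$L_\alpha[0,1]^2=\{f\in C_\alpha[0,1]^2:\dim_{\mathrm B}G_f=\alpha\text{ and }\alpha-1<\underline{\dim}_{\mathrm B}G_{H(f)}\le\overline{\dim}_{\mathrm B}G_{H(f)}\le2\}.$$ Then (1) $U_\alpha[0,1]^2$ is not a prevalent subset of $(C_\alpha[0,1]^2,d_{\alpha,2})$; (2) $L_\alpha[0,1]^2$ is not a prevalent subset of $(C_\alpha[0,1]^2,d_{\alpha,2})$.
   Context: For $d\in\{1,2\}$, $C[0,1]^d$ is the real vector space of continuous functions $f:[0,1]^d\to\mathbb{R}$, with sup norm $\|\cdot\|_\infty$. The graph of $f$ is $G_f=\{(\mathbf{x},f(\mathbf{x})):\mathbf{x}\in[0,1]^d\}\subset\mathbb{R}^{d+1}$. For $f\in C[0,1]^2$ the horizon function $H(f)\in C[0,1]$ is $H(f)(x)=\sup_{y\in[0,1]}f(x,y)$. For a bounded set $F$ in Euclidean space, $\underline{\dim}_{\mathrm B}F$ and $\overline{\dim}_{\mathrm B}F$ are the lower and upper limits as $\delta\to0$ of $\log N_\delta(F)/(-\log\delta)$, where $N_\delta(F)$ is the number of cubes of a $\delta$-mesh which intersect $F$; if they agree the common value is $\dim_{\mathrm B}F$. "$\dim_{\mathrm B}G_f=\alpha$"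 means that the box dimension exists and equals $\alpha$. For $\alpha\in[2,3)$ define $C_\alpha[0,1]^2=\{f\in C[0,1]^2:\overline{\dim}_{\mathrm B}G_f\le\alpha\}$. Metric $d_{\alpha,2}$: for $\delta>0$, $\Delta_\delta^2$ is the collection of squares $[n_1\delta,(n_1+1)\delta]\times[n_2\delta,(n_2+1)\delta]$ with integers $0\le n_i\le\lceil\delta^{-1}\rceil-1$. For $S\in\Delta_\delta^2$, $R_f(S)=\sup|f(x)-f(y)|$ over $x,y\in S\cap[0,1]^2$. For $\beta\ge2$ put $\|f\|_{\beta,2}=\|f\|_\infty+\sup_{0<\delta\le1}\delta^{\beta-1}\sum_{S\in\Delta_\delta^2}R_f(S)$. For $f,g\in C_\alpha[0,1]^2$, $d_{\alpha,2}(f,g)=\sum_{k=1}^\infty\min\{2^{-k},\|f-g\|_{\alpha+\frac1k,2}\}$. With this metric $C_\alpha[0,1]^2$ is a completely metrizable topological vector space. A subset $F$ of a completely metrizable topological vector space $X$ is prevalent if (1) $F$ is a Borel set and (2) there exist a Borel measure $\mu$ on $X$ and a compact set $K\subseteq X$ such that $0<\mu(K)<\infty$ and $\mu(X\setminus(F+x))=0$ for all $x\in X$. *)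

theory Defs
  imports "HOL-Analysis.Analysis" "HOL-Library.Function_Algebras"
begin

section \<open>Box dimensions\<close>

definition mesh_cube :: "real \<Rightarrow> ('a::euclidean_space \<Rightarrow> int) \<Rightarrow> 'a set" where
  "mesh_cube \<delta> n = {x. \<forall>b\<in>Basis. of_int (n b) * \<delta> \<le> x \<bullet> b \<and> x \<bullet> b \<le> (of_int (n b) + 1) * \<delta>}"

definition mesh_count :: "real \<Rightarrow> 'a::euclidean_space set \<Rightarrow> nat" where
  "mesh_count \<delta> F = card {Q \<in> range (mesh_cube \<delta>). Q \<inter> F \<noteq> {}}"

definition lower_box_dim :: "'a::euclidean_space set \<Rightarrow> ereal" where
  "lower_box_dim F = Liminf (at_right 0) (\<lambda>\<delta>. ereal (ln (real (mesh_count \<delta> F)) / (- ln \<delta>)))"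

definition upper_box_dim :: "'a::euclidean_space set \<Rightarrow> ereal" where
  "upper_box_dim F = Limsup (at_right 0) (\<lambda>\<delta>. ereal (ln (real (mesh_count \<delta> F)) / (- ln \<delta>)))"

definition has_box_dim :: "'a::euclidean_space set \<Rightarrow> real \<Rightarrow> bool" where
  "has_box_dim F a \<longleftrightarrow> lower_box_dim F = ereal a \<and> upper_box_dim F = ereal a"

section \<open>Continuous functions, graphs and horizons\<close>

abbreviation unit_square :: "(real \<times> real) set" where
  "unit_square \<equiv> {0..1} \<times> {0..1}"

text \<open>A function on \<open>A\<close> is represented by its extension by 0 to the whole type, so that equality
  and the pointwise operations on the type are those of functions on \<open>A\<close>.\<close>

definition cont_funs :: "'a::topological_space set \<Rightarrow> ('a \<Rightarrow> real) set" where
  "cont_funs A = {f. continuous_on A f \<and> (\<forall>x. x \<notin> A \<longrightarrow> f x = 0)}"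

definition graph_on :: "'a set \<Rightarrow> ('a \<Rightarrow> real) \<Rightarrow> ('a \<times> real) set" where
  "graph_on A f = (\<lambda>x. (x, f x)) ` A"

definition horizon :: "(real \<times> real \<Rightarrow> real) \<Rightarrow> real \<Rightarrow> real" where
  "horizon f x = (if x \<in> {0..1} then (SUP y\<in>{0..1}. f (x, y)) else 0)"

definition C_dim :: "real \<Rightarrow> (real \<times> real \<Rightarrow> real) set" where
  "C_dim \<alpha> = {f \<in> cont_funs unit_square. upper_box_dim (graph_on unit_square f) \<le> ereal \<alpha>}"

section \<open>The metric\<close>

definition grid_squares :: "real \<Rightarrow> (real \<times> real) set set" where
  "grid_squares \<delta> =
     {{of_int n1 * \<delta> .. (of_int n1 + 1) * \<delta>} \<times> {of_int n2 * \<delta> .. (of_int n2 + 1) * \<delta>} | n1 n2 :: int.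
        0 \<le> n1 \<and> n1 \<le> \<lceil>1 / \<delta>\<rceil> - 1 \<and> 0 \<le> n2 \<and> n2 \<le> \<lceil>1 / \<delta>\<rceil> - 1}"

text \<open>The supremum over \<open>\<delta>\<close> below may be infinite, hence the extended nonnegative reals. The
  truncation by \<open>2\<^sup>-\<^sup>k\<close> makes each summand of \<open>dist_dim\<close> finite, so \<open>enn2real\<close> loses nothing
  there.\<close>

definition osc :: "(real \<times> real \<Rightarrow> real) \<Rightarrow> (real \<times> real) set \<Rightarrow> ennreal" where
  "osc f S = (SUP p\<in>S \<inter> unit_square. SUP q\<in>S \<inter> unit_square. ennreal \<bar>f p - f q\<bar>)"

definition osc_norm :: "real \<Rightarrow> (real \<times> real \<Rightarrow> real) \<Rightarrow> ennreal" where
  "osc_norm \<beta> f = (SUP p\<in>unit_square. ennreal \<bar>f p\<bar>)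
     + (SUP \<delta>\<in>{0<..1}. ennreal (\<delta> powr (\<beta> - 1)) * (\<Sum>S\<in>grid_squares \<delta>. osc f S))"

text \<open>The series over \<open>k \<ge> 1\<close> is written with index \<open>Suc k\<close>.\<close>

definition dist_dim :: "real \<Rightarrow> (real \<times> real \<Rightarrow> real) \<Rightarrow> (real \<times> real \<Rightarrow> real) \<Rightarrow> real" where
  "dist_dim \<alpha> f g =
     (\<Sum>k. enn2real (min (ennreal ((1/2) ^ Suc k)) (osc_norm (\<alpha> + 1 / real (Suc k)) (f - g))))"

lemma osc_triangle: "osc (f - h) S \<le> osc (f - g) S + osc (g - h) S"
  unfolding osc_def
proof (intro SUP_least)
  fix p q assume pq: "p \<in> S \<inter> unit_square" "q \<in> S \<inter> unit_square"
  have "ennreal \<bar>(f - h) p - (f - h) q\<bar>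
      \<le> ennreal \<bar>(f - g) p - (f - g) q\<bar> + ennreal \<bar>(g - h) p - (g - h) q\<bar>"
    by (auto simp flip: ennreal_plus intro!: ennreal_leI)
  also have "\<dots> \<le> (SUP p\<in>S \<inter> unit_square. SUP q\<in>S \<inter> unit_square. ennreal \<bar>(f - g) p - (f - g) q\<bar>)
      + (SUP p\<in>S \<inter> unit_square. SUP q\<in>S \<inter> unit_square. ennreal \<bar>(g - h) p - (g - h) q\<bar>)"
    using pq by (intro add_mono SUP_upper2[OF pq(1)] SUP_upper2[OF pq(2)] order_refl)
  finally show "ennreal \<bar>(f - h) p - (f - h) q\<bar> \<le> \<dots>" .
qed

lemma osc_norm_triangle: "osc_norm \<beta> (f - h) \<le> osc_norm \<beta> (f - g) + osc_norm \<beta> (g - h)"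
proof -
  let ?s = "\<lambda>f. SUP p\<in>unit_square. ennreal \<bar>f p\<bar>"
  let ?T = "\<lambda>f \<delta>. ennreal (\<delta> powr (\<beta> - 1)) * (\<Sum>S\<in>grid_squares \<delta>. osc f S)"
  have "?s (f - h) \<le> ?s (f - g) + ?s (g - h)"
  proof (rule SUP_least)
    fix p :: "real \<times> real" assume p: "p \<in> unit_square"
    have "ennreal \<bar>(f - h) p\<bar> \<le> ennreal \<bar>(f - g) p\<bar> + ennreal \<bar>(g - h) p\<bar>"
      by (auto simp flip: ennreal_plus intro!: ennreal_leI)
    also have "\<dots> \<le> ?s (f - g) + ?s (g - h)"
      using p by (intro add_mono SUP_upper)
    finally show "ennreal \<bar>(f - h) p\<bar> \<le> \<dots>" .
  qed
  moreover have "(SUP \<delta>\<in>{0<..1}. ?T (f - h) \<delta>)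
      \<le> (SUP \<delta>\<in>{0<..1}. ?T (f - g) \<delta>) + (SUP \<delta>\<in>{0<..1}. ?T (g - h) \<delta>)"
  proof (rule SUP_least)
    fix \<delta> :: real assume d: "\<delta> \<in> {0<..1}"
    have "?T (f - h) \<delta> \<le> ?T (f - g) \<delta> + ?T (g - h) \<delta>"
      unfolding distrib_left[symmetric] sum.distrib[symmetric]
      by (intro mult_left_mono sum_mono osc_triangle) auto
    also have "\<dots> \<le> (SUP \<delta>\<in>{0<..1}. ?T (f - g) \<delta>) + (SUP \<delta>\<in>{0<..1}. ?T (g - h) \<delta>)"
      using d by (intro add_mono SUP_upper)
    finally show "?T (f - h) \<delta> \<le> \<dots>" .
  qed
  ultimately have "osc_norm \<beta> (f - h) \<le> (?s (f - g) + ?s (g - h))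
      + ((SUP \<delta>\<in>{0<..1}. ?T (f - g) \<delta>) + (SUP \<delta>\<in>{0<..1}. ?T (g - h) \<delta>))"
    unfolding osc_norm_def by (rule add_mono)
  then show ?thesis unfolding osc_norm_def by (simp add: ac_simps)
qed

lemma osc_norm_commute: "osc_norm \<beta> (f - g) = osc_norm \<beta> (g - f)"
proof -
  have "\<bar>(f - g) p\<bar> = \<bar>(g - f) p\<bar>" "\<bar>(f - g) p - (f - g) q\<bar> = \<bar>(g - f) p - (g - f) q\<bar>" for p q
    by simp_all
  then show ?thesis unfolding osc_norm_def osc_def by (simp only:)
qed

lemma osc_norm_zero [simp]: "osc_norm \<beta> 0 = 0"
proof -
  have "osc 0 S = 0" for S
    unfolding osc_def by (auto simp: SUP_eq_iff bot_ennreal intro!: antisym SUP_least)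
  then show ?thesis
    unfolding osc_norm_def by (auto intro!: antisym SUP_least)
qed

lemma Metric_space_dist_dim: "Metric_space (C_dim \<alpha>) (dist_dim \<alpha>)"
proof -
  define t where "t f g k = enn2real (min (ennreal ((1/2) ^ Suc k))
      (osc_norm (\<alpha> + 1 / real (Suc k)) (f - g)))" for f g k
  have D: "dist_dim \<alpha> f g = suminf (t f g)" for f g
    unfolding dist_dim_def t_def ..
  have t: "ennreal (t f g k) = min (ennreal ((1/2) ^ Suc k)) (osc_norm (\<alpha> + 1 / real (Suc k)) (f - g))"
    for f g k
    unfolding t_def by (rule ennreal_enn2real) (simp add: min_less_iff_disj ennreal_less_top)
  have t_nonneg: "0 \<le> t f g k" for f g k by (simp add: t_def)
  have t_le: "t f g k \<le> (1/2) ^ Suc k" for f g k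
    by (rule ennreal_le_iff[THEN iffD1]) (auto simp: t)
  have summ: "summable (t f g)" for f g
    by (rule summable_comparison_test'[of "\<lambda>k. (1/2) ^ Suc k" 0])
       (use t_nonneg t_le in \<open>auto intro!: summable_mult summable_geometric\<close>)
  have tri: "t f h k \<le> t f g k + t g h k" for f g h k
  proof -
    have "ennreal (t f h k) \<le> ennreal (t f g k) + ennreal (t g h k)"
      unfolding t using osc_norm_triangle[of "\<alpha> + 1 / real (Suc k)" f h g]
      by (auto simp: min_def intro: order_trans add_increasing add_increasing2)
    then show ?thesis using t_nonneg by (simp flip: ennreal_plus)
  qed
  have zero: "f = g" if fg: "f \<in> C_dim \<alpha>" "g \<in> C_dim \<alpha>" "dist_dim \<alpha> f g = 0" for f g
  proof
    fix p
    have "t f g 0 = 0"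
      using fg(3) suminf_eq_zero_iff[OF summ t_nonneg] unfolding D by blast
    then have "min (ennreal (1/2)) (osc_norm (\<alpha> + 1) (f - g)) = 0"
      using t[of f g 0] by simp
    then have "osc_norm (\<alpha> + 1) (f - g) = 0"
      by (simp add: min_def split: if_splits)
    then have "(SUP p\<in>unit_square. ennreal \<bar>f p - g p\<bar>) = 0"
      by (simp add: osc_norm_def)
    then have "ennreal \<bar>f p - g p\<bar> \<le> 0" if "p \<in> unit_square"
      using SUP_upper[OF that, of "\<lambda>p. ennreal \<bar>f p - g p\<bar>"] by simp
    moreover have "f p = g p" if "p \<notin> unit_square"
      using fg(1,2) that unfolding C_dim_def cont_funs_def by (metis (mono_tags, lifting) mem_Collect_eq)
    ultimately show "f p = g p" by (cases "p \<in> unit_square") auto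
  qed
  show ?thesis
  proof
    show "0 \<le> dist_dim \<alpha> f g" for f g
      unfolding D by (intro suminf_nonneg summ t_nonneg)
    show "dist_dim \<alpha> f g = dist_dim \<alpha> g f" for f g
      unfolding dist_dim_def by (subst osc_norm_commute) (rule refl)
    show "dist_dim \<alpha> f g = 0 \<longleftrightarrow> f = g" if "f \<in> C_dim \<alpha>" "g \<in> C_dim \<alpha>" for f g
      using zero[OF that] by (auto simp: dist_dim_def)
    show "dist_dim \<alpha> f h \<le> dist_dim \<alpha> f g + dist_dim \<alpha> g h" for f g h
      unfolding D suminf_add[OF summ summ] by (intro suminf_le tri summ summable_add)
  qed
qed

definition C_dim_top :: "real \<Rightarrow> (real \<times> real \<Rightarrow> real) topology" where
  "C_dim_top \<alpha> = Metric_space.mtopology (C_dim \<alpha>) (dist_dim \<alpha>)"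

section \<open>Prevalence\<close>

text \<open>The vector space under consideration is the carrier \<open>topspace T\<close> with the addition of the
  ambient type. Membership in \<open>null_sets\<close>, rather than \<open>emeasure \<mu> _ = 0\<close>, is used because
  \<open>emeasure\<close> is 0 on non-measurable sets by convention.\<close>

definition borel_of_top :: "'v topology \<Rightarrow> 'v measure" where
  "borel_of_top T = sigma (topspace T) {U. openin T U}"

definition prevalent :: "'v::ab_group_add topology \<Rightarrow> 'v set \<Rightarrow> bool" where
  "prevalent T F \<longleftrightarrow> F \<in> sets (borel_of_top T) \<and>
     (\<exists>\<mu> K. space \<mu> = topspace T \<and> sets \<mu> = sets (borel_of_top T) \<and>
        compactin T K \<and> 0 < emeasure \<mu> K \<and> emeasure \<mu> K < \<infinity> \<and>
        (\<forall>x\<in>topspace T. topspace T - (\<lambda>f. f + x) ` F \<in> null_sets \<mu>))"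

section \<open>The two families\<close>

definition U_dim :: "real \<Rightarrow> (real \<times> real \<Rightarrow> real) set" where
  "U_dim \<alpha> = {f \<in> C_dim \<alpha>. has_box_dim (graph_on unit_square f) \<alpha> \<and>
     ereal (\<alpha> - 1) \<le> lower_box_dim (graph_on {0..1} (horizon f)) \<and>
     lower_box_dim (graph_on {0..1} (horizon f)) \<le> upper_box_dim (graph_on {0..1} (horizon f)) \<and>
     upper_box_dim (graph_on {0..1} (horizon f)) < 2}"

definition L_dim :: "real \<Rightarrow> (real \<times> real \<Rightarrow> real) set" where
  "L_dim \<alpha> = {f \<in> C_dim \<alpha>. has_box_dim (graph_on unit_square f) \<alpha> \<and>
     ereal (\<alpha> - 1) < lower_box_dim (graph_on {0..1} (horizon f)) \<and>
     lower_box_dim (graph_on {0..1} (horizon f)) \<le> upper_box_dim (graph_on {0..1} (horizon f)) \<and>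
     upper_box_dim (graph_on {0..1} (horizon f)) \<le> 2}"

end

theory Submission
  imports Defs
begin

text \<open>Let \<open>\<mu>\<close> and the compact set \<open>K\<close> witness prevalence. The functions in \<open>K\<close> share a vertical modulus
  of continuity \<open>p\<close>, and \<open>(t, y) \<mapsto> p \<bar>y - y0\<bar>\<close> has a graph of dimension 2. After subtracting it, the
  horizon of every \<open>f \<in> K\<close> becomes the trace \<open>f (\<cdot>, y0)\<close>.

  For \<open>U\<close>, take \<open>y0 = 0\<close> and compare this translation with a second one that also adds a surface of
  dimension 2 whose trace \<open>w\<close> on \<open>y = 0\<close> has dimension 2. Some \<open>f \<in> K\<close> is good for both translations,
  but \<open>f (\<cdot>, 0)\<close> and \<open>f (\<cdot>, 0) + w\<close> cannot both have upper dimension less than 2.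

  For \<open>L\<close>, a counting argument shows that for almost every \<open>y0\<close> the trace \<open>f (\<cdot>, y0)\<close> has lower
  dimension at most \<open>\<alpha> - 1\<close> for \<open>\<mu>\<close>-almost all \<open>f \<in> K\<close>.\<close>

section \<open>Counting mesh cubes\<close>

text \<open>A translation is admissible only if its upper dimension is at most \<alpha>, and
  \<alpha> = 2 is allowed, so each translating surface must have dimension at most 2. A surface
  depending on \<open>y\<close> alone, with bounded variation in \<open>y\<close>, meets this for
  any modulus \<open>p\<close>; compactness of \<open>K\<close> gives one \<open>p\<close> for all
  of \<open>K\<close>.

  For \<open>U\<close>, the second difference of \<open>w\<close> on each of the 2^n dyadic
  intervals of level n is 1/(n+1)^2. The oscillations of two curves differing by \<open>w\<close>
  must account for it on every interval, so together they need at least about 4^n/n^2 cubes. The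
  weights are summable, which makes \<open>w\<close> continuous, yet cost only a polynomial factor.

  For \<open>L\<close>, the oscillation sum over the 4^n squares of level n is at most about
  2^((\<alpha>-1)n). An average row among 2^n then holds 2^((\<alpha>-2)n), and a curve with that
  oscillation sum needs about 2^((\<alpha>-1)n) cubes. The translation may depend on
  \<open>K\<close> but not on \<open>f\<close>, so \<open>y0\<close> has to be chosen before
  \<open>f\<close>; hence the averaging over \<open>K\<close>.\<close>

definition meeting_cubes :: "real \<Rightarrow> 'a::euclidean_space set \<Rightarrow> 'a set set" where
  "meeting_cubes \<delta> F = {Q \<in> range (mesh_cube \<delta>). Q \<inter> F \<noteq> {}}"

lemma mesh_count_eq: "mesh_count \<delta> F = card (meeting_cubes \<delta> F)"
  by (simp add: mesh_count_def meeting_cubes_def)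

lemma mesh_cube_real:
  "mesh_cube \<delta> n = {of_int (n 1) * \<delta> .. (of_int (n 1) + 1) * \<delta>::real}"
  by (auto simp: mesh_cube_def)

lemma range_mesh_cube_real:
  "range (mesh_cube \<delta>) = range (\<lambda>m::int. {of_int m * \<delta> .. (of_int m + 1) * \<delta>::real})"
  by (auto simp: mesh_cube_real intro!: image_eqI[where x = "\<lambda>_. _"])

lemma mesh_cube_prod:
  "mesh_cube \<delta> (n :: 'a::euclidean_space \<times> 'b::euclidean_space \<Rightarrow> int) =
     mesh_cube \<delta> (\<lambda>b. n (b, 0)) \<times> mesh_cube \<delta> (\<lambda>b. n (0, b))"
  by (auto simp: mesh_cube_def Basis_prod_def ball_Un)

lemma range_mesh_cube_prod:
  "range (mesh_cube \<delta> :: ('a::euclidean_space \<times> 'b::euclidean_space \<Rightarrow> int) \<Rightarrow> _) =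
     (\<lambda>(Q, R). Q \<times> R) ` (range (mesh_cube \<delta>) \<times> range (mesh_cube \<delta>))"
proof (intro equalityI subsetI)
  fix S :: "('a \<times> 'b) set"
  assume "S \<in> (\<lambda>(Q, R). Q \<times> R) ` (range (mesh_cube \<delta>) \<times> range (mesh_cube \<delta>))"
  then obtain n m where S: "S = mesh_cube \<delta> n \<times> mesh_cube \<delta> m" by auto
  \<comment> \<open>Basis vectors of the product are \<open>(a, 0)\<close> and \<open>(0, b)\<close>
    with nonzero entries, so \<open>b = 0\<close> tells the two kinds apart.\<close>
  have "S = mesh_cube \<delta> (\<lambda>(a, b). if b = 0 then n a else m b)"
    unfolding S mesh_cube_prod by (auto simp: mesh_cube_def)
  then show "S \<in> range (mesh_cube \<delta>)" by blast
qed (auto simp: mesh_cube_prod)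

lemma mesh_cube_bounds:
  assumes "0 < \<delta>" "\<And>x. x \<in> F \<Longrightarrow> norm x \<le> B" "mesh_cube \<delta> n \<inter> F \<noteq> {}" "b \<in> Basis"
  shows "n b \<in> {- \<lceil>B / \<delta>\<rceil> - 1 .. \<lceil>B / \<delta>\<rceil>}"
proof -
  obtain x where x: "x \<in> mesh_cube \<delta> n" "x \<in> F" using assms(3) by blast
  have "\<bar>x \<bullet> b\<bar> \<le> B"
    using Basis_le_norm[OF assms(4), of x] assms(2)[OF x(2)] by linarith
  moreover have "of_int (n b) * \<delta> \<le> x \<bullet> b" "x \<bullet> b \<le> (of_int (n b) + 1) * \<delta>"
    using x(1) assms(4) by (auto simp: mesh_cube_def)
  ultimately have "of_int (n b) * \<delta> \<le> B" "- B \<le> (of_int (n b) + 1) * \<delta>" by auto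
  then have "of_int (n b) \<le> B / \<delta>" "- (B / \<delta>) \<le> of_int (n b) + 1"
    using assms(1) by (auto simp: field_simps)
  then show ?thesis by simp linarith
qed

text \<open>\<open>card\<close> is 0 on infinite sets, so finiteness is what makes comparisons of
  \<open>mesh_count\<close> meaningful.\<close>

lemma finite_meeting_cubes:
  fixes F :: "'a::euclidean_space set"
  assumes "0 < \<delta>" "bounded F"
  shows "finite (meeting_cubes \<delta> F)"
proof -
  obtain B where B: "\<And>x. x \<in> F \<Longrightarrow> norm x \<le> B" using assms(2) by (auto simp: bounded_iff)
  have "meeting_cubes \<delta> F \<subseteq> mesh_cube \<delta> ` (Basis \<rightarrow>\<^sub>E {- \<lceil>B / \<delta>\<rceil> - 1 .. \<lceil>B / \<delta>\<rceil>})"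
  proof
    fix Q assume "Q \<in> meeting_cubes \<delta> F"
    then obtain n where n: "Q = mesh_cube \<delta> n" "Q \<inter> F \<noteq> {}" by (auto simp: meeting_cubes_def)
    \<comment> \<open>A cube depends only on the values of its index on \<open>Basis\<close>;
      restricting leaves a finite function space.\<close>
    have "Q = mesh_cube \<delta> (restrict n Basis)" by (simp add: n(1) mesh_cube_def)
    moreover have "restrict n Basis \<in> Basis \<rightarrow>\<^sub>E {- \<lceil>B / \<delta>\<rceil> - 1 .. \<lceil>B / \<delta>\<rceil>}"
      using mesh_cube_bounds[OF assms(1) B, where n = n] n by auto
    ultimately show "Q \<in> mesh_cube \<delta> ` (Basis \<rightarrow>\<^sub>E {- \<lceil>B / \<delta>\<rceil> - 1 .. \<lceil>B / \<delta>\<rceil>})" by blast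
  qed
  then show ?thesis by (rule finite_subset) (intro finite_imageI finite_PiE, auto)
qed

text \<open>A mesh cube is a product \<open>Q \<times> R\<close>, and it meets the graph exactly
  when \<open>R\<close> meets the image of \<open>Q \<inter> A\<close>. Counting column by column is
  exact because cubes meeting a set are nonempty, so the product determines both factors.\<close>

lemma mesh_count_graph_on:
  fixes f :: "'a::euclidean_space \<Rightarrow> real"
  assumes "0 < \<delta>" "bounded A" "bounded (f ` A)"
  shows "mesh_count \<delta> (graph_on A f) = (\<Sum>Q\<in>meeting_cubes \<delta> A. mesh_count \<delta> (f ` (Q \<inter> A)))"
proof -
  let ?S = "Sigma (meeting_cubes \<delta> A) (\<lambda>Q. meeting_cubes \<delta> (f ` (Q \<inter> A)))"
  have "meeting_cubes \<delta> (graph_on A f) = (\<lambda>(Q, R). Q \<times> R) ` ?S"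
  proof (intro equalityI subsetI)
    fix S assume "S \<in> meeting_cubes \<delta> (graph_on A f)"
    then obtain Q R x where "S = Q \<times> R" "Q \<in> range (mesh_cube \<delta>)" "R \<in> range (mesh_cube \<delta>)"
      "x \<in> A" "x \<in> Q" "f x \<in> R"
      unfolding meeting_cubes_def range_mesh_cube_prod graph_on_def by auto
    then show "S \<in> (\<lambda>(Q, R). Q \<times> R) ` ?S"
      by (intro image_eqI[where x = "(Q, R)"]) (auto simp: meeting_cubes_def)
  next
    fix S assume "S \<in> (\<lambda>(Q, R). Q \<times> R) ` ?S"
    then obtain Q R where "S = Q \<times> R" "Q \<in> range (mesh_cube \<delta>)" "R \<in> range (mesh_cube \<delta>)"
      "R \<inter> f ` (Q \<inter> A) \<noteq> {}" by (auto simp: meeting_cubes_def)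
    then show "S \<in> meeting_cubes \<delta> (graph_on A f)"
      unfolding meeting_cubes_def range_mesh_cube_prod graph_on_def by auto
  qed
  moreover have "inj_on (\<lambda>(Q, R). Q \<times> R) ?S"
    unfolding inj_on_def meeting_cubes_def by (auto simp: times_eq_iff)
  ultimately have "mesh_count \<delta> (graph_on A f) = card ?S"
    by (simp add: mesh_count_eq card_image)
  also have "\<dots> = (\<Sum>Q\<in>meeting_cubes \<delta> A. card (meeting_cubes \<delta> (f ` (Q \<inter> A))))"
    by (intro card_SigmaI finite_meeting_cubes assms ballI bounded_subset[OF assms(3)]) auto
  finally show ?thesis by (simp add: mesh_count_eq)
qed

lemma inj_mesh_interval:
  assumes "0 < \<delta>" shows "inj (\<lambda>m::int. {of_int m * \<delta> .. (of_int m + 1) * \<delta>::real})"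
  using assms by (auto simp: inj_on_def Icc_eq_Icc mult_right_mono)

text \<open>A connected set contains the whole segment between two of its points, hence meets every
  mesh interval along it.\<close>

lemma mesh_count_ge:
  fixes E :: "real set"
  assumes "0 < \<delta>" "bounded E" "connected E" "a \<in> E" "b \<in> E"
  shows "\<bar>a - b\<bar> \<le> \<delta> * mesh_count \<delta> E"
proof -
  have *: "b - a \<le> \<delta> * mesh_count \<delta> E" if ab: "a \<in> E" "b \<in> E" "a \<le> b" for a b
  proof -
    let ?I = "\<lambda>m::int. {of_int m * \<delta> .. (of_int m + 1) * \<delta>}"
    have sub: "{a..b} \<subseteq> E" using assms(3) ab connected_contains_Icc by blast
    have "?I m \<in> meeting_cubes \<delta> E" if m: "m \<in> {\<lfloor>a / \<delta>\<rfloor>..\<lfloor>b / \<delta>\<rfloor>}" for m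
    proof -
      have "a / \<delta> < of_int m + 1" "of_int m \<le> b / \<delta>" using m by (auto; linarith)+
      then have "a \<le> (of_int m + 1) * \<delta>" "of_int m * \<delta> \<le> b"
        using assms(1) by (auto simp: field_simps)
      then have "max a (of_int m * \<delta>) \<in> ?I m \<inter> {a..b}"
        using assms(1) ab by (auto simp: algebra_simps)
      then have "?I m \<inter> E \<noteq> {}" using sub by blast
      then show ?thesis unfolding meeting_cubes_def range_mesh_cube_real by blast
    qed
    then have "card (?I ` {\<lfloor>a / \<delta>\<rfloor>..\<lfloor>b / \<delta>\<rfloor>}) \<le> mesh_count \<delta> E"
      unfolding mesh_count_eq using assms(1,2) by (intro card_mono finite_meeting_cubes) auto
    moreover have "card (?I ` {\<lfloor>a / \<delta>\<rfloor>..\<lfloor>b / \<delta>\<rfloor>}) = nat (\<lfloor>b / \<delta>\<rfloor> - \<lfloor>a / \<delta>\<rfloor> + 1)"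
      using inj_mesh_interval[OF assms(1)] by (subst card_image) (auto intro: inj_on_subset)
    moreover have "b / \<delta> - a / \<delta> \<le> real (nat (\<lfloor>b / \<delta>\<rfloor> - \<lfloor>a / \<delta>\<rfloor> + 1))"
      by linarith
    ultimately have "(b - a) / \<delta> \<le> mesh_count \<delta> E"
      by (simp add: diff_divide_distrib)
    then show ?thesis using assms(1) by (simp add: field_simps)
  qed
  show ?thesis using *[of a b] *[of b a] assms(4,5) by linarith
qed

text \<open>Around any of its points \<open>a\<close>, the set lies in
  \<open>[a - R, a + R]\<close>, of length \<open>2 * R\<close>; the 2 allows for partial and
  touching intervals at the two ends.\<close>

lemma mesh_count_le:
  fixes E :: "real set"
  assumes "0 < \<delta>" "0 \<le> R" "\<And>a b. a \<in> E \<Longrightarrow> b \<in> E \<Longrightarrow> \<bar>a - b\<bar> \<le> R"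
  shows "mesh_count \<delta> E \<le> 2 * R / \<delta> + 2"
proof (cases "E = {}")
  case True
  then show ?thesis using assms(1,2) by (simp add: mesh_count_eq meeting_cubes_def)
next
  case False
  then obtain a where a: "a \<in> E" by blast
  let ?I = "\<lambda>m::int. {of_int m * \<delta> .. (of_int m + 1) * \<delta>}"
  let ?l = "\<lceil>(a - R) / \<delta>\<rceil> - 1" and ?u = "\<lfloor>(a + R) / \<delta>\<rfloor>"
  have "meeting_cubes \<delta> E \<subseteq> ?I ` {?l..?u}"
  proof
    fix Q assume "Q \<in> meeting_cubes \<delta> E"
    then obtain m b where m: "Q = ?I m" and "b \<in> Q" "b \<in> E"
      unfolding meeting_cubes_def range_mesh_cube_real by blast
    then have b: "b \<in> E" "of_int m * \<delta> \<le> b" "b \<le> (of_int m + 1) * \<delta>" by auto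
    have "of_int m * \<delta> \<le> a + R" "a - R \<le> (of_int m + 1) * \<delta>"
      using assms(3)[OF a b(1)] b by auto
    then have "of_int m \<le> (a + R) / \<delta>" "(a - R) / \<delta> \<le> of_int m + 1"
      using assms(1) by (auto simp: field_simps)
    then have "m \<in> {?l..?u}" by simp linarith
    then show "Q \<in> ?I ` {?l..?u}" using m by blast
  qed
  then have "mesh_count \<delta> E \<le> card {?l..?u}"
    unfolding mesh_count_eq by (intro surj_card_le) auto
  also have "real (card {?l..?u}) \<le> (a + R) / \<delta> - (a - R) / \<delta> + 2"
  proof -
    have "(a - R) / \<delta> \<le> (a + R) / \<delta>" using assms(1,2) by (intro divide_right_mono) auto
    then show ?thesis by simp linarith
  qed
  also have "\<dots> = 2 * R / \<delta> + 2" by (simp add: diff_divide_distrib[symmetric])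
  finally show ?thesis by simp
qed

section \<open>Passing between mesh counts and box dimensions\<close>

lemma eventually_at_right_less_one: "\<forall>\<^sub>F \<delta> in at_right 0. (0::real) < \<delta> \<and> \<delta> < 1"
  unfolding eventually_at_right_field by (intro exI[of _ 1]) auto

lemma upper_box_dim_less_eventually:
  assumes "upper_box_dim F < ereal s"
  shows "\<forall>\<^sub>F \<delta> in at_right 0. mesh_count \<delta> F \<le> \<delta> powr (- s)"
proof -
  have "\<forall>\<^sub>F \<delta> in at_right 0. ereal (ln (real (mesh_count \<delta> F)) / (- ln \<delta>)) < ereal s"
    using assms unfolding upper_box_dim_def by (rule Limsup_lessD)
  moreover have "\<forall>\<^sub>F \<delta> in at_right 0. (0::real) < \<delta> \<and> \<delta> < 1"
    by (rule eventually_at_right_less_one)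
  ultimately show ?thesis
  proof eventually_elim
    case (elim \<delta>)
    show ?case
    \<comment> \<open>\<open>ln 0 = 0\<close> by convention, so the logarithmic inequality says
      nothing about a zero count.\<close>
    proof (cases "mesh_count \<delta> F = 0")
      case False
      have "ln (real (mesh_count \<delta> F)) < - s * ln \<delta>"
        using elim by (simp add: field_simps)
      then have "exp (ln (real (mesh_count \<delta> F))) \<le> exp (- s * ln \<delta>)" by simp
      then show ?thesis using False elim by (simp add: powr_def)
    qed simp
  qed
qed

text \<open>The constant contributes \<open>ln C / (- ln \<delta>)\<close>, which drops below any
  \<open>e > 0\<close>. The bound \<open>0 \<le> s\<close> covers zero counts, whose ratio is
  0.\<close>

lemma upper_box_dim_leI:
  assumes "0 < C" "\<And>\<delta>. 0 < \<delta> \<Longrightarrow> \<delta> < 1 \<Longrightarrow> mesh_count \<delta> F \<le> C * \<delta> powr (- s)" "0 \<le> s"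
  shows "upper_box_dim F \<le> ereal s"
proof (rule ereal_le_epsilon2)
  fix e :: real assume e: "0 < e"
  have lim: "filterlim (\<lambda>\<delta>::real. - ln \<delta>) at_top (at_right 0)"
    by (rule filterlim_compose[OF filterlim_uminus_at_top_at_bot ln_at_0])
  have "\<forall>\<^sub>F \<delta> in at_right 0. max 0 (ln C) / e \<le> - ln (\<delta>::real)"
    using lim by (simp only: filterlim_at_top)
  moreover have "\<forall>\<^sub>F \<delta> in at_right 0. (0::real) < \<delta> \<and> \<delta> < 1"
    by (rule eventually_at_right_less_one)
  ultimately have "\<forall>\<^sub>F \<delta> in at_right 0.
      ereal (ln (real (mesh_count \<delta> F)) / (- ln \<delta>)) \<le> ereal (s + e)"
  proof eventually_elim
    case (elim \<delta>)
    have C: "ln C \<le> e * (- ln \<delta>)" using elim(1) e by (simp add: field_simps)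
    have "ln (real (mesh_count \<delta> F)) \<le> (s + e) * (- ln \<delta>)"
    proof (cases "mesh_count \<delta> F = 0")
      case True
      then show ?thesis using elim e assms(3) by (simp add: mult_nonneg_nonpos)
    next
      case False
      then have "ln (real (mesh_count \<delta> F)) \<le> ln (C * \<delta> powr (- s))"
        using assms elim by (subst ln_le_cancel_iff) auto
      also have "\<dots> = ln C - s * ln \<delta>" using assms elim by (simp add: ln_mult ln_powr)
      finally show ?thesis using C by (simp add: algebra_simps)
    qed
    then show ?case using elim by (simp add: field_simps)
  qed
  then show "upper_box_dim F \<le> ereal s + ereal e"
    unfolding upper_box_dim_def by (simp add: Limsup_bounded)
qed

lemma eventually_half_power:
  assumes "\<forall>\<^sub>F \<delta> in at_right (0::real). P \<delta>"
  shows "\<forall>\<^sub>F n in sequentially. P ((1/2) ^ n)"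
proof -
  have "filterlim (\<lambda>n. (1/2::real) ^ n) (at_right 0) sequentially"
    unfolding filterlim_at by (auto intro!: LIMSEQ_power_zero)
  from this assms show ?thesis by (auto simp: filterlim_iff)
qed

text \<open>A lower limit is bounded by the behaviour along any one sequence of scales, so dyadic
  scales suffice.\<close>

lemma lower_box_dim_leI:
  fixes s :: real
  assumes "0 < C" "\<forall>\<^sub>F n in sequentially. mesh_count ((1/2) ^ n) F \<le> C * 2 powr (s * n)" "0 \<le> s"
  shows "lower_box_dim F \<le> ereal s"
proof (rule ccontr)
  assume "\<not> lower_box_dim F \<le> ereal s"
  then have "ereal s < lower_box_dim F" by simp
  from ereal_dense2[OF this] obtain r where r: "ereal s < ereal r" "ereal r < lower_box_dim F"
    by auto
  have "\<forall>\<^sub>F \<delta> in at_right 0. ereal r < ereal (ln (real (mesh_count \<delta> F)) / (- ln \<delta>))"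
    using r(2) unfolding lower_box_dim_def by (rule less_LiminfD)
  from eventually_half_power[OF this]
  have 1: "\<forall>\<^sub>F n in sequentially. r < ln (real (mesh_count ((1/2) ^ n) F)) / (- ln ((1/2) ^ n))" by simp
  have 2: "\<forall>\<^sub>F n in sequentially. max 0 (ln C) / ((r - s) * ln 2) \<le> real n"
    using filterlim_real_sequentially by (simp add: filterlim_at_top)
  have "\<forall>\<^sub>F n in sequentially. False"
    using 1 2 assms(2) eventually_gt_at_top[of 0]
  proof eventually_elim
    case (elim n)
    let ?N = "mesh_count ((1/2) ^ n) F"
    have rs: "0 < r - s" using r by simp
    have l: "- ln ((1/2::real) ^ n) = n * ln 2" by (simp add: ln_realpow ln_div)
    have "r * (n * ln 2) < ln ?N"
      using elim(1,4) unfolding l by (simp add: field_simps)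
    moreover have "max 0 (ln C) \<le> n * ((r - s) * ln 2)"
      using elim(2) rs by (simp add: pos_divide_le_eq)
    moreover have "ln ?N \<le> max 0 (ln C) + s * (n * ln 2)"
    proof (cases "?N = 0")
      case True
      then show ?thesis using assms(3) by simp
    next
      case False
      then have "ln ?N \<le> ln (C * 2 powr (s * n))" using assms(1) elim by (subst ln_le_cancel_iff) auto
      also have "\<dots> = ln C + s * (n * ln 2)" using assms(1) by (simp add: ln_mult ln_powr)
      finally show ?thesis by simp
    qed
    ultimately show False by (simp add: algebra_simps)
  qed
  then show False by simp
qed

section \<open>Surfaces with dimension at most 2\<close>

lemma mesh_cube_real_prod_cases:
  assumes "Q \<in> range (mesh_cube \<delta>)"
  obtains i j :: int where
    "Q = {of_int i * \<delta>..(of_int i + 1) * \<delta>} \<times> {of_int j * \<delta>..(of_int j + 1) * \<delta> :: real}"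
proof -
  obtain n where "Q = mesh_cube \<delta> n" using assms by blast
  then show thesis unfolding mesh_cube_prod mesh_cube_real by (rule that)
qed

lemma mesh_interval_meets_unit:
  fixes i :: int and \<delta> :: real
  assumes "0 < \<delta>" "{of_int i * \<delta>..(of_int i + 1) * \<delta>} \<inter> {0..1} \<noteq> {}"
  shows "i \<in> {-1..\<lceil>1 / \<delta>\<rceil>}"
proof -
  have "of_int i * \<delta> \<le> 1" "0 \<le> (of_int i + 1) * \<delta>" using assms(2) by auto
  then have "of_int i \<le> 1 / \<delta>" "0 \<le> of_int i + (1::real)"
    using assms(1) by (simp_all only: pos_le_divide_eq zero_le_mult_iff) auto
  then show ?thesis by simp linarith
qed

text \<open>The oscillation of \<open>f\<close> on a \<open>\<delta>\<close>-cell is controlled by the row \<open>j\<close> of the cell alone, and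
  the sum over the rows is bounded independently of \<open>\<delta>\<close>. There are about \<open>1 / \<delta>\<close> cells per row, so the
  graph meets \<open>O(\<delta>\<^sup>-\<^sup>2)\<close> cubes. The rows \<open>-1\<close> and \<open>\<lceil>1 / \<delta>\<rceil>\<close> occur because the mesh cubes are closed.\<close>

definition rowwise_bounded :: "real \<Rightarrow> (real \<times> real \<Rightarrow> real) \<Rightarrow> bool" where
  "rowwise_bounded C f \<longleftrightarrow> (\<forall>\<delta>. 0 < \<delta> \<and> \<delta> < 1 \<longrightarrow> (\<exists>\<rho>::int \<Rightarrow> real.
     (\<forall>j. 0 \<le> \<rho> j) \<and> (\<Sum>j\<in>{-1..\<lceil>1 / \<delta>\<rceil>}. \<rho> j) \<le> C \<and>
     (\<forall>j. \<forall>p\<in>unit_square. \<forall>q\<in>unit_square. \<bar>fst p - fst q\<bar> \<le> \<delta> \<longrightarrow>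
        {snd p, snd q} \<subseteq> {of_int j * \<delta>..(of_int j + 1) * \<delta>} \<longrightarrow> \<bar>f p - f q\<bar> \<le> \<rho> j)))"

lemma rowwise_boundedE:
  assumes "rowwise_bounded C f" "0 < \<delta>" "\<delta> < 1"
  obtains \<rho> :: "int \<Rightarrow> real" where "\<And>j. 0 \<le> \<rho> j" "(\<Sum>j\<in>{-1..\<lceil>1 / \<delta>\<rceil>}. \<rho> j) \<le> C"
    "\<And>j p q. p \<in> unit_square \<Longrightarrow> q \<in> unit_square \<Longrightarrow> \<bar>fst p - fst q\<bar> \<le> \<delta> \<Longrightarrow>
        {snd p, snd q} \<subseteq> {of_int j * \<delta>..(of_int j + 1) * \<delta>} \<Longrightarrow> \<bar>f p - f q\<bar> \<le> \<rho> j"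
  using assms(1)[unfolded rowwise_bounded_def, rule_format, OF conjI[OF assms(2,3)]] that by metis

text \<open>Row bounds at the same scale add up. This keeps \<open>ridge p 0 - bumps\<close> at
  dimension at most 2, where bounds on the dimensions of the two graphs would not combine so
  directly.\<close>

lemma rowwise_bounded_diff:
  assumes "rowwise_bounded C f" "rowwise_bounded D g"
  shows "rowwise_bounded (C + D) (f - g)"
  unfolding rowwise_bounded_def
proof (intro allI impI)
  fix \<delta> :: real assume d: "0 < \<delta> \<and> \<delta> < 1"
  obtain \<rho> :: "int \<Rightarrow> real" where \<rho>: "\<And>j. 0 \<le> \<rho> j" "(\<Sum>j\<in>{-1..\<lceil>1 / \<delta>\<rceil>}. \<rho> j) \<le> C"
    "\<And>j p q. p \<in> unit_square \<Longrightarrow> q \<in> unit_square \<Longrightarrow> \<bar>fst p - fst q\<bar> \<le> \<delta> \<Longrightarrow>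
        {snd p, snd q} \<subseteq> {of_int j * \<delta>..(of_int j + 1) * \<delta>} \<Longrightarrow> \<bar>f p - f q\<bar> \<le> \<rho> j"
    using assms(1) d by (elim rowwise_boundedE) auto
  obtain \<sigma> :: "int \<Rightarrow> real" where \<sigma>: "\<And>j. 0 \<le> \<sigma> j" "(\<Sum>j\<in>{-1..\<lceil>1 / \<delta>\<rceil>}. \<sigma> j) \<le> D"
    "\<And>j p q. p \<in> unit_square \<Longrightarrow> q \<in> unit_square \<Longrightarrow> \<bar>fst p - fst q\<bar> \<le> \<delta> \<Longrightarrow>
        {snd p, snd q} \<subseteq> {of_int j * \<delta>..(of_int j + 1) * \<delta>} \<Longrightarrow> \<bar>g p - g q\<bar> \<le> \<sigma> j"
    using assms(2) d by (elim rowwise_boundedE) auto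
  show "\<exists>\<rho>::int \<Rightarrow> real. (\<forall>j. 0 \<le> \<rho> j) \<and> (\<Sum>j\<in>{-1..\<lceil>1 / \<delta>\<rceil>}. \<rho> j) \<le> C + D \<and>
     (\<forall>j. \<forall>p\<in>unit_square. \<forall>q\<in>unit_square. \<bar>fst p - fst q\<bar> \<le> \<delta> \<longrightarrow>
        {snd p, snd q} \<subseteq> {of_int j * \<delta>..(of_int j + 1) * \<delta>} \<longrightarrow> \<bar>(f - g) p - (f - g) q\<bar> \<le> \<rho> j)"
  proof (intro exI[of _ "\<lambda>j. \<rho> j + \<sigma> j"] conjI allI ballI impI)
    show "(\<Sum>j\<in>{-1..\<lceil>1 / \<delta>\<rceil>}. \<rho> j + \<sigma> j) \<le> C + D"
      unfolding sum.distrib using \<rho>(2) \<sigma>(2) by linarith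
  next
    fix j p q
    assume "p \<in> unit_square" "q \<in> unit_square" "\<bar>fst p - fst q\<bar> \<le> \<delta>"
      "{snd p, snd q} \<subseteq> {of_int j * \<delta>..(of_int j + 1) * \<delta>}"
    from \<rho>(3)[OF this] \<sigma>(3)[OF this] show "\<bar>(f - g) p - (f - g) q\<bar> \<le> \<rho> j + \<sigma> j" by simp
  qed (use \<rho>(1) \<sigma>(1) in simp)
qed

lemma upper_box_dim_graph_rowwise_bounded:
  assumes "rowwise_bounded C f" "bounded (f ` unit_square)"
  shows "upper_box_dim (graph_on unit_square f) \<le> ereal 2"
proof (rule upper_box_dim_leI)
  have C: "0 \<le> C"
    by (rule rowwise_boundedE[OF assms(1), of "1/2"]) (auto intro: order_trans[OF sum_nonneg])
  \<comment> \<open>The constant is the product of \<open>4 / \<delta>\<close> columns and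
    \<open>2 * C / \<delta> + 2 * (4 / \<delta>)\<close> cubes per column.\<close>
  then show "0 < 8 * C + 32" by simp
  fix \<delta> :: real assume d: "0 < \<delta>" "\<delta> < 1"
  obtain \<rho> :: "int \<Rightarrow> real" where \<rho>: "\<And>j. 0 \<le> \<rho> j" "(\<Sum>j\<in>{-1..\<lceil>1 / \<delta>\<rceil>}. \<rho> j) \<le> C"
    "\<And>j p q. p \<in> unit_square \<Longrightarrow> q \<in> unit_square \<Longrightarrow> \<bar>fst p - fst q\<bar> \<le> \<delta> \<Longrightarrow>
        {snd p, snd q} \<subseteq> {of_int j * \<delta>..(of_int j + 1) * \<delta>} \<Longrightarrow> \<bar>f p - f q\<bar> \<le> \<rho> j"
    using assms(1) d by (elim rowwise_boundedE) auto
  let ?J = "{-1..\<lceil>1 / \<delta>\<rceil>}"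
  define cell where "cell = (\<lambda>(i::int, j::int).
    {of_int i * \<delta>..(of_int i + 1) * \<delta>} \<times> {of_int j * \<delta>..(of_int j + 1) * \<delta>})"
  have le4: "real (card ?J) \<le> 4 / \<delta>"
  proof -
    have "\<lceil>1 / \<delta>\<rceil> \<ge> 1" using d by simp
    then have "real (card ?J) \<le> 1 / \<delta> + 3" unfolding card_atLeastAtMost_int by linarith
    also have "\<dots> \<le> 4 / \<delta>" using d by (simp add: field_simps)
    finally show ?thesis .
  qed
  have sub: "meeting_cubes \<delta> unit_square \<subseteq> cell ` (?J \<times> ?J)"
  proof
    fix Q :: "(real \<times> real) set" assume Q: "Q \<in> meeting_cubes \<delta> unit_square"
    then have "Q \<in> range (mesh_cube \<delta>)" by (simp add: meeting_cubes_def)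
    then obtain i j where ij: "Q = cell (i, j)"
      unfolding cell_def prod.case by (rule mesh_cube_real_prod_cases)
    obtain a b where "(a, b) \<in> Q" "(a, b) \<in> unit_square"
      using Q unfolding meeting_cubes_def by fast
    then have "a \<in> {of_int i * \<delta>..(of_int i + 1) * \<delta>} \<inter> {0..1}"
      "b \<in> {of_int j * \<delta>..(of_int j + 1) * \<delta>} \<inter> {0..1}"
      unfolding ij cell_def by auto
    then have "i \<in> ?J" "j \<in> ?J"
      by (blast intro: mesh_interval_meets_unit[OF d(1)])+
    then show "Q \<in> cell ` (?J \<times> ?J)" using ij by blast
  qed
  have count: "real (mesh_count \<delta> (f ` (cell ij \<inter> unit_square))) \<le> 2 * \<rho> (snd ij) / \<delta> + 2" for ij
  proof (rule mesh_count_le[OF d(1) \<rho>(1)])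
    fix a b assume "a \<in> f ` (cell ij \<inter> unit_square)" "b \<in> f ` (cell ij \<inter> unit_square)"
    then obtain p q where pq: "a = f p" "b = f q" "p \<in> cell ij" "q \<in> cell ij"
      "p \<in> unit_square" "q \<in> unit_square" by blast
    have "\<bar>fst p - fst q\<bar> \<le> \<delta>"
      using pq(3,4) by (auto simp: cell_def split: prod.splits) (auto simp: algebra_simps)
    moreover have "{snd p, snd q} \<subseteq> {of_int (snd ij) * \<delta>..(of_int (snd ij) + 1) * \<delta>}"
      using pq(3,4) by (auto simp: cell_def split: prod.splits)
    ultimately show "\<bar>a - b\<bar> \<le> \<rho> (snd ij)" using \<rho>(3) pq by blast
  qed
  have "real (mesh_count \<delta> (graph_on unit_square f)) =
      (\<Sum>Q\<in>meeting_cubes \<delta> unit_square. real (mesh_count \<delta> (f ` (Q \<inter> unit_square))))"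
    using assms(2) d by (subst mesh_count_graph_on) (auto intro: bounded_Times)
  also have "\<dots> \<le> (\<Sum>Q\<in>cell ` (?J \<times> ?J). real (mesh_count \<delta> (f ` (Q \<inter> unit_square))))"
    using sub by (intro sum_mono2) auto
  also have "\<dots> \<le> (\<Sum>ij\<in>?J \<times> ?J. real (mesh_count \<delta> (f ` (cell ij \<inter> unit_square))))"
    by (rule order_trans[OF sum_image_le]) auto
  also have "\<dots> \<le> (\<Sum>ij\<in>?J \<times> ?J. 2 * \<rho> (snd ij) / \<delta> + 2)"
    by (intro sum_mono count)
  also have "\<dots> = (\<Sum>i\<in>?J. \<Sum>j\<in>?J. 2 * \<rho> j / \<delta> + 2)"
    by (subst sum.cartesian_product) (simp only: case_prod_unfold)
  also have "\<dots> = card ?J * (\<Sum>j\<in>?J. 2 / \<delta> * \<rho> j + 2)"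
    by (simp only: sum_constant times_divide_eq_left)
  also have "\<dots> = card ?J * (2 / \<delta> * (\<Sum>j\<in>?J. \<rho> j) + 2 * real (card ?J))"
    by (simp add: sum.distrib sum_distrib_left del: card_atLeastAtMost_int)
  also have "\<dots> \<le> 4 / \<delta> * (2 / \<delta> * C + 2 * (4 / \<delta>))"
  proof (rule mult_mono[OF le4])
    have "2 / \<delta> * (\<Sum>j\<in>?J. \<rho> j) \<le> 2 / \<delta> * C" using \<rho>(2) d by (intro mult_left_mono) auto
    then show "2 / \<delta> * (\<Sum>j\<in>?J. \<rho> j) + 2 * real (card ?J) \<le> 2 / \<delta> * C + 2 * (4 / \<delta>)"
      using le4 by linarith
    show "0 \<le> 2 / \<delta> * (\<Sum>j\<in>?J. \<rho> j) + 2 * real (card ?J)"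
      using d by (intro add_nonneg_nonneg mult_nonneg_nonneg sum_nonneg \<rho>(1)) auto
  qed (use d in auto)
  also have "\<dots> = (8 * C + 32) * \<delta> powr (- 2)"
  proof -
    have "\<delta> powr (- 2) = 1 / (\<delta> * \<delta>)"
      using d by (simp add: powr_minus power2_eq_square divide_inverse)
    then show ?thesis by (simp add: algebra_simps add_divide_distrib)
  qed
  finally show "real (mesh_count \<delta> (graph_on unit_square f)) \<le> (8 * C + 32) * \<delta> powr - 2" .
qed simp

lemma sum_int_telescope:
  fixes g :: "int \<Rightarrow> real"
  shows "(\<Sum>j\<in>{a..a + int n}. g (j + 1) - g j) = g (a + int n + 1) - g a"
proof (induction n)
  case (Suc n)
  have "{a..a + int (Suc n)} = insert (a + int n + 1) {a..a + int n}" by auto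
  moreover have "a + int n + 1 \<notin> {a..a + int n}" by auto
  ultimately have "(\<Sum>j\<in>{a..a + int (Suc n)}. g (j + 1) - g j) =
      (g (a + int n + 1 + 1) - g (a + int n + 1)) + (\<Sum>j\<in>{a..a + int n}. g (j + 1) - g j)"
    by (simp only: sum.insert finite_atLeastAtMost_int not_False_eq_True)
  then show ?case unfolding Suc.IH by (simp add: add_ac)
qed simp

text \<open>\<open>V\<close> acts as a variation function in \<open>y\<close>: its increment across
  a row bounds the oscillation there, and the increments telescope to at most \<open>B\<close> at
  every scale.\<close>

lemma rowwise_bounded_monotone:
  fixes V :: "real \<Rightarrow> real"
  assumes "mono V" "\<And>x y. V x - V y \<le> B"
    "\<And>p q. p \<in> unit_square \<Longrightarrow> q \<in> unit_square \<Longrightarrow> snd p \<le> snd q \<Longrightarrow> \<bar>f p - f q\<bar> \<le> V (snd q) - V (snd p)"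
  shows "rowwise_bounded B f"
  unfolding rowwise_bounded_def
proof (intro allI impI)
  fix \<delta> :: real assume d: "0 < \<delta> \<and> \<delta> < 1"
  show "\<exists>\<rho>::int \<Rightarrow> real. (\<forall>j. 0 \<le> \<rho> j) \<and> (\<Sum>j\<in>{-1..\<lceil>1 / \<delta>\<rceil>}. \<rho> j) \<le> B \<and>
     (\<forall>j. \<forall>p\<in>unit_square. \<forall>q\<in>unit_square. \<bar>fst p - fst q\<bar> \<le> \<delta> \<longrightarrow>
        {snd p, snd q} \<subseteq> {of_int j * \<delta>..(of_int j + 1) * \<delta>} \<longrightarrow> \<bar>f p - f q\<bar> \<le> \<rho> j)"
  proof (intro exI[of _ "\<lambda>j. V (of_int (j + 1) * \<delta>) - V (of_int j * \<delta>)"] conjI allI ballI impI)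
    fix j :: int
    show "0 \<le> V (of_int (j + 1) * \<delta>) - V (of_int j * \<delta>)"
      using d by (simp add: monoD[OF assms(1)] mult_right_mono)
  next
    have "0 < \<lceil>1 / \<delta>\<rceil>" using d by simp
    then have "-1 \<le> \<lceil>1 / \<delta>\<rceil>" by linarith
    then obtain n where "\<lceil>1 / \<delta>\<rceil> = -1 + int n" by (rule zle_iff_zadd[THEN iffD1, THEN exE])
    then show "(\<Sum>j\<in>{-1..\<lceil>1 / \<delta>\<rceil>}. V (of_int (j + 1) * \<delta>) - V (of_int j * \<delta>)) \<le> B"
      using sum_int_telescope[of "\<lambda>j. V (of_int j * \<delta>)" "-1" n] assms(2) by (simp only:)
  next
    fix j p q
    assume pq: "p \<in> unit_square" "q \<in> unit_square" "{snd p, snd q} \<subseteq> {of_int j * \<delta>..(of_int j + 1) * \<delta>}"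
    then have V: "V (of_int j * \<delta>) \<le> V (snd p)" "V (snd p) \<le> V (of_int (j + 1) * \<delta>)"
      "V (of_int j * \<delta>) \<le> V (snd q)" "V (snd q) \<le> V (of_int (j + 1) * \<delta>)"
      by (auto intro!: monoD[OF assms(1)])
    show "\<bar>f p - f q\<bar> \<le> V (of_int (j + 1) * \<delta>) - V (of_int j * \<delta>)"
    proof (cases "snd p \<le> snd q")
      case True
      then show ?thesis using assms(3)[OF pq(1,2)] V by linarith
    next
      case False
      then show ?thesis using assms(3)[OF pq(2,1)] V by linarith
    qed
  qed
qed

section \<open>Tents, dyadic second differences and the surface \<open>bumps\<close>\<close>

definition tent :: "real \<Rightarrow> real" where
  "tent x = \<bar>x - of_int (round x)\<bar>"

lemma tent_nonneg: "0 \<le> tent x"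
  by (simp add: tent_def)

lemma tent_le_half: "tent x \<le> 1 / 2"
  unfolding tent_def using of_int_round_abs_le[of x] by (simp add: abs_minus_commute)

text \<open>At a half-integer \<open>round\<close> picks one neighbour; the closed hypothesis
  permits either, as the affine pieces need at their endpoints.\<close>

lemma tent_eq:
  assumes "\<bar>x - of_int c\<bar> \<le> 1 / 2" shows "tent x = \<bar>x - of_int c\<bar>"
proof (rule antisym)
  show "tent x \<le> \<bar>x - of_int c\<bar>" unfolding tent_def by (rule round_diff_minimal)
  show "\<bar>x - of_int c\<bar> \<le> tent x"
  proof (cases "round x = c")
    case False
    then have "1 \<le> \<bar>round x - c\<bar>" by linarith
    then have "1 \<le> \<bar>real_of_int (round x) - of_int c\<bar>"
      by (metis of_int_1_le_iff of_int_abs of_int_diff)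
    then show ?thesis using assms unfolding tent_def by linarith
  qed (simp add: tent_def)
qed

lemma tent_lipschitz: "\<bar>tent x - tent y\<bar> \<le> \<bar>x - y\<bar>"
  using round_diff_minimal[of x "round y"] round_diff_minimal[of y "round x"]
  unfolding tent_def by linarith

lemma tent_int: "tent (of_int c) = 0"
  by (simp add: tent_eq[of _ c])

lemma tent_half_int: "tent (of_int c + 1 / 2) = 1 / 2"
  by (subst tent_eq[of _ c]) auto

lemma tent_affine:
  fixes m :: int
  assumes "of_int m / 2 \<le> u" "u \<le> (of_int m + 1) / 2" "of_int m / 2 \<le> v" "v \<le> (of_int m + 1) / 2"
  shows "tent u + tent v = 2 * tent ((u + v) / 2)"
proof (cases "even m")
  case True
  then obtain c where c: "m = 2 * c" by (elim evenE)
  have *: "tent x = x - of_int c" if "of_int m / 2 \<le> x" "x \<le> (of_int m + 1) / 2" for x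
    using that unfolding c by (subst tent_eq[of _ c]) auto
  show ?thesis using assms by (subst (1 2 3) *) (auto simp: field_simps)
next
  case False
  then obtain c where c: "m = 2 * c + 1" by (elim oddE)
  have *: "tent x = of_int c + 1 - x" if "of_int m / 2 \<le> x" "x \<le> (of_int m + 1) / 2" for x
    using that unfolding c by (subst tent_eq[of _ "c + 1"]) auto
  show ?thesis using assms by (subst (1 2 3) *) (auto simp: field_simps)
qed

text \<open>Three cases. For \<open>k = n\<close> the midpoint is a peak between two zeros. For
  \<open>k > n\<close> all three sample points are integers, where \<open>tent\<close> vanishes. For
  \<open>k < n\<close> they lie in one half-unit interval, where \<open>tent\<close> is
  affine.\<close>

lemma tent_second_difference:
  fixes n k i :: nat
  defines "x \<equiv> \<lambda>t. tent (2 ^ k * (t / 2 ^ n))"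
  shows "2 * x (i + 1 / 2) - x i - x (i + 1) = (if k = n then 1 else 0)"
proof -
  consider "k = n" | d where "k = n + Suc d" | d where "n = k + Suc d"
    by (metis add_Suc_right less_imp_Suc_add linorder_neqE_nat)
  then show ?thesis
  proof cases
    case 1
    then show ?thesis
      using tent_int[of "int i"] tent_int[of "int i + 1"] tent_half_int[of "int i"] by (simp add: x_def add.commute)
  next
    case (2 d)
    have *: "x t = tent (2 ^ d * (2 * t))" for t
      by (simp add: x_def 2 power_add mult_ac)
    show ?thesis
      using tent_int[of "2 ^ d * (2 * int i)"] tent_int[of "2 ^ d * (2 * (int i + 1))"]
        tent_int[of "2 ^ d * (2 * int i + 1)"] 2 by (simp add: * distrib_left add_ac)
  next
    case (3 d)
    have *: "x t = tent (t / (2 * 2 ^ d))" for t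
      by (simp add: x_def 3 power_add)
    \<comment> \<open>\<open>i\<close> and \<open>i + 1\<close> lie in one block of length
      \<open>2 ^ d\<close>; dividing by \<open>2 * 2 ^ d\<close> turns it into the half-unit
      interval starting at \<open>m / 2\<close>.\<close>
    define m where "m = int (i div 2 ^ d)"
    have "i div 2 ^ d * 2 ^ d \<le> i" "i + 1 \<le> (i div 2 ^ d + 1) * 2 ^ d"
      using dividend_less_div_times[of "2 ^ d" i] by (simp_all add: Suc_leI)
    then have "real (i div 2 ^ d * 2 ^ d) \<le> real i" "real (i + 1) \<le> real ((i div 2 ^ d + 1) * 2 ^ d)"
      by (simp_all only: of_nat_le_iff)
    then have "of_int m * 2 ^ d \<le> real i" "real i + 1 \<le> (of_int m + 1) * 2 ^ d"
      by (simp_all add: m_def algebra_simps)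
    then have "real_of_int m / 2 \<le> i / (2 * 2 ^ d)" "(i + 1) / (2 * 2 ^ d) \<le> (real_of_int m + 1) / 2"
      by (simp_all add: pos_le_divide_eq pos_divide_le_eq)
    moreover have "i / (2 * 2 ^ d) \<le> (i + 1) / (2 * 2 ^ d :: real)"
      by (intro divide_right_mono) auto
    ultimately have "tent (i / (2 * 2 ^ d)) + tent ((i + 1) / (2 * 2 ^ d)) =
        2 * tent ((i / (2 * 2 ^ d) + (i + 1) / (2 * 2 ^ d)) / 2)"
      by (intro tent_affine[of m]) linarith+
    also have "(i / (2 * 2 ^ d) + (i + 1) / (2 * 2 ^ d)) / 2 = (i + 1 / 2) / (2 * 2 ^ d :: real)"
      by (simp add: field_simps)
    finally have "tent (i / (2 * 2 ^ d)) + tent ((i + 1) / (2 * 2 ^ d)) =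
        2 * tent ((i + 1 / 2) / (2 * 2 ^ d))" .
    moreover have "k \<noteq> n" using 3 by simp
    ultimately show ?thesis unfolding * by simp
  qed
qed

text \<open>Summable, yet decaying slower than any exponential; \<open>Suc\<close> avoids division
  by 0.\<close>

definition weight :: "nat \<Rightarrow> real" where
  "weight k = 1 / (real (Suc k))\<^sup>2"

lemma weight_nonneg: "0 \<le> weight k"
  by (simp add: weight_def)

lemma norm_weight_mult_le:
  assumes "0 \<le> x" "x \<le> 1" shows "norm (weight k * x) \<le> weight k"
  using mult_left_le[OF assms(2) weight_nonneg[of k]] weight_nonneg[of k] assms(1)
  by (simp add: abs_mult)

lemma summable_weight: "summable weight"
proof -
  have "summable (\<lambda>k. inverse (real (Suc k) ^ 2))"
    using inverse_power_summable[of 2, where 'a = real] by (subst summable_Suc_iff) simp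
  then show ?thesis by (simp add: weight_def[abs_def] divide_inverse)
qed

definition bump :: "nat \<Rightarrow> real \<times> real \<Rightarrow> real" where
  "bump k p = tent (2 ^ k * fst p) * max 0 (1 - 2 ^ k * snd p)"

text \<open>The cutoff \<open>max 0 (1 - 2 ^ k * y)\<close> confines the oscillations of frequency \<open>2 ^ k\<close> to a strip of
  height \<open>2 ^ (-k)\<close>. Thus the surface keeps dimension 2, although its trace on \<open>y = 0\<close> is a
  Takagi-type curve of dimension 2; there the second difference on a dyadic interval of level \<open>n\<close> only
  sees the term \<open>k = n\<close>.\<close>

definition bumps :: "real \<times> real \<Rightarrow> real" where
  "bumps p = (\<Sum>k. weight k * bump k p)"

lemma bump_bounds:
  assumes "0 \<le> snd p" shows "0 \<le> bump k p" "bump k p \<le> 1"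
proof -
  show "0 \<le> bump k p" by (simp add: bump_def tent_nonneg)
  have "tent (2 ^ k * fst p) * max 0 (1 - 2 ^ k * snd p) \<le> 1 * 1"
    using assms tent_le_half[of "2 ^ k * fst p"] by (intro mult_mono) (auto simp: tent_nonneg)
  then show "bump k p \<le> 1" by (simp add: bump_def)
qed

lemma summable_bumps:
  assumes "0 \<le> snd p" shows "summable (\<lambda>k. weight k * bump k p)"
  by (rule summable_comparison_test'[OF summable_weight, of 0])
     (rule norm_weight_mult_le[OF bump_bounds[OF assms]])

text \<open>Each cutoff factor is largest at \<open>y = 0\<close>, so adding \<open>bumps\<close>
  does not move a vertical maximum away from that line.\<close>

lemma bumps_le_base:
  assumes "0 \<le> y" shows "bumps (t, y) \<le> bumps (t, 0)"
  unfolding bumps_def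
  by (intro suminf_le summable_bumps mult_left_mono weight_nonneg)
     (use assms in \<open>auto simp: bump_def tent_nonneg intro!: mult_left_le\<close>)

lemma abs_diff_max_0: "\<bar>max 0 a - max 0 b\<bar> \<le> \<bar>a - b\<bar>" for a b :: real
  by (simp add: max_def)

lemma bump_diff:
  assumes "p \<in> unit_square" "q \<in> unit_square"
  shows "\<bar>bump k p - bump k q\<bar> \<le> 2 ^ k * \<bar>fst p - fst q\<bar> + 2 ^ k * \<bar>snd p - snd q\<bar>"
proof -
  let ?t = "\<lambda>p. tent (2 ^ k * fst p)" and ?c = "\<lambda>p::real \<times> real. max 0 (1 - 2 ^ k * snd p)"
  have "bump k p - bump k q = (?t p - ?t q) * ?c p + ?t q * (?c p - ?c q)"
    by (simp add: bump_def algebra_simps)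
  also have "\<bar>\<dots>\<bar> \<le> \<bar>?t p - ?t q\<bar> * 1 + 1 * \<bar>?c p - ?c q\<bar>"
  proof (rule order_trans[OF abs_triangle_ineq], unfold abs_mult, intro add_mono mult_mono)
    show "\<bar>?c p\<bar> \<le> 1" using assms by auto
    show "\<bar>?t q\<bar> \<le> 1" using tent_le_half[of "2 ^ k * fst q"] tent_nonneg[of "2 ^ k * fst q"] by auto
  qed auto
  also have "\<dots> \<le> \<bar>2 ^ k * fst p - 2 ^ k * fst q\<bar> + \<bar>(1 - 2 ^ k * snd p) - (1 - 2 ^ k * snd q)\<bar>"
    using tent_lipschitz abs_diff_max_0 by (auto intro!: add_mono)
  also have "\<dots> = 2 ^ k * \<bar>fst p - fst q\<bar> + 2 ^ k * \<bar>snd p - snd q\<bar>"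
    by (simp add: abs_mult abs_minus_commute flip: right_diff_distrib)
  finally show ?thesis .
qed

lemma continuous_on_bumps: "continuous_on unit_square bumps"
proof -
  have bump: "continuous_on unit_square (bump k)" for k
  proof -
    have "continuous_on UNIV tent"
      by (rule lipschitz_on_continuous_on[of 1], rule lipschitz_onI)
         (simp_all add: dist_real_def tent_lipschitz)
    then show ?thesis
      unfolding bump_def[abs_def]
      by (intro continuous_intros continuous_on_compose2[OF \<open>continuous_on UNIV tent\<close>]) auto
  qed
  have "uniform_limit unit_square (\<lambda>n p. \<Sum>k<n. weight k * bump k p) (\<lambda>p. \<Sum>k. weight k * bump k p) sequentially"
  proof (rule Weierstrass_m_test[OF _ summable_weight])
    fix k and p :: "real \<times> real" assume "p \<in> unit_square"
    then have "0 \<le> snd p" by auto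
    then show "norm (weight k * bump k p) \<le> weight k" by (intro norm_weight_mult_le bump_bounds)
  qed
  then show ?thesis
    unfolding bumps_def[abs_def]
    by (rule uniform_limit_theorem[rotated]) (auto intro!: always_eventually continuous_intros bump)
qed

text \<open>Frequency \<open>2 ^ k\<close> is felt only in rows whose lower edge is at height at
  most \<open>2 ^ (-k)\<close>. There are at most \<open>1 / (2 ^ k * \<delta>) + 2\<close> of them,
  each with oscillation at most \<open>min 1 (2 * 2 ^ k * \<delta>)\<close>, so the sum over the
  rows is at most 4 for every \<open>k\<close>.\<close>

lemma rowwise_bounded_bumps: "rowwise_bounded (4 * suminf weight) bumps"
  unfolding rowwise_bounded_def
proof (intro allI impI)
  fix \<delta> :: real assume d: "0 < \<delta> \<and> \<delta> < 1"
  define b where "b j k = (if 2 ^ k * (of_int j * \<delta>) \<le> 1 then min 1 (2 * 2 ^ k * \<delta>) else 0)" for j :: int and k :: nat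
  define J where "J = {-1..\<lceil>1 / \<delta>\<rceil>}"
  have b01: "0 \<le> b j k" "b j k \<le> 1" for j k using d by (auto simp: b_def)
  have summ: "summable (\<lambda>k. weight k * b j k)" for j
    by (rule summable_comparison_test'[OF summable_weight, of 0]) (rule norm_weight_mult_le[OF b01])
  have bump_le: "\<bar>bump k p - bump k q\<bar> \<le> b j k"
    if pq: "p \<in> unit_square" "q \<in> unit_square" "\<bar>fst p - fst q\<bar> \<le> \<delta>"
      "{snd p, snd q} \<subseteq> {of_int j * \<delta>..(of_int j + 1) * \<delta>}" for j k p q
  proof (cases "2 ^ k * (of_int j * \<delta>) \<le> 1")
    case True
    have "\<bar>bump k p - bump k q\<bar> \<le> 1"
      using bump_bounds[of p k] bump_bounds[of q k] pq(1,2) by auto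
    moreover have "\<bar>snd p - snd q\<bar> \<le> \<delta>" using pq(4) by (auto simp: algebra_simps)
    then have "2 ^ k * \<bar>fst p - fst q\<bar> + 2 ^ k * \<bar>snd p - snd q\<bar> \<le> 2 ^ k * \<delta> + 2 ^ k * \<delta>"
      using pq(3) by (intro add_mono mult_left_mono) auto
    then have "\<bar>bump k p - bump k q\<bar> \<le> 2 * 2 ^ k * \<delta>"
      using bump_diff[OF pq(1,2), of k] by linarith
    ultimately show ?thesis using True by (simp add: b_def)
  next
    case False
    have "2 ^ k * (of_int j * \<delta>) \<le> 2 ^ k * snd p" "2 ^ k * (of_int j * \<delta>) \<le> 2 ^ k * snd q"
      using pq(4) by (auto intro!: mult_left_mono)
    then have "1 \<le> 2 ^ k * snd p" "1 \<le> 2 ^ k * snd q" using False by linarith+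
    then show ?thesis using False by (simp add: bump_def b_def)
  qed
  have sum_b: "(\<Sum>j\<in>J. b j k) \<le> 4" for k
  proof -
    define c where "c = min 1 (2 * 2 ^ k * \<delta>)"
    let ?N = "{j \<in> J. 2 ^ k * (of_int j * \<delta>) \<le> 1}"
    have c: "0 \<le> c" "c \<le> 1" "c \<le> 2 * 2 ^ k * \<delta>" using d by (auto simp: c_def)
    have pos: "0 < 2 ^ k * \<delta>" using d by simp
    have "?N \<subseteq> {-1..\<lfloor>1 / (2 ^ k * \<delta>)\<rfloor>}"
      using pos by (auto simp: J_def le_floor_iff pos_le_divide_eq mult_ac)
    then have "card ?N \<le> card {-1..\<lfloor>1 / (2 ^ k * \<delta>)\<rfloor>}" by (intro card_mono) auto
    moreover have "0 \<le> 1 / (2 ^ k * \<delta>)" using pos by simp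
    then have "real (card {-1..\<lfloor>1 / (2 ^ k * \<delta>)\<rfloor>}) \<le> 1 / (2 ^ k * \<delta>) + 2"
      unfolding card_atLeastAtMost_int by linarith
    ultimately have card: "real (card ?N) \<le> 1 / (2 ^ k * \<delta>) + 2" by linarith
    have "(\<Sum>j\<in>J. b j k) = (\<Sum>j\<in>?N. c)"
      by (simp add: b_def c_def J_def sum.If_cases Int_def)
    also have "\<dots> = card ?N * c" by simp
    also have "\<dots> \<le> (1 / (2 ^ k * \<delta>) + 2) * c" using card c by (intro mult_right_mono)
    also have "\<dots> = c / (2 ^ k * \<delta>) + 2 * c" by (simp add: algebra_simps)
    \<comment> \<open>The bound \<open>c \<le> 2 * 2 ^ k * \<delta>\<close> controls the first
      summand and \<open>c \<le> 1\<close> the second, each by 2.\<close>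
    also have "\<dots> \<le> 4" using c pos by (simp add: pos_divide_le_eq add_mono[of _ 2 _ 2, simplified])
    finally show ?thesis .
  qed
  show "\<exists>\<rho>::int \<Rightarrow> real. (\<forall>j. 0 \<le> \<rho> j) \<and> (\<Sum>j\<in>{-1..\<lceil>1 / \<delta>\<rceil>}. \<rho> j) \<le> 4 * suminf weight \<and>
     (\<forall>j. \<forall>p\<in>unit_square. \<forall>q\<in>unit_square. \<bar>fst p - fst q\<bar> \<le> \<delta> \<longrightarrow>
        {snd p, snd q} \<subseteq> {of_int j * \<delta>..(of_int j + 1) * \<delta>} \<longrightarrow> \<bar>bumps p - bumps q\<bar> \<le> \<rho> j)"
    unfolding J_def[symmetric]
  proof (intro exI[of _ "\<lambda>j. \<Sum>k. weight k * b j k"] conjI allI ballI impI)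
    show "0 \<le> (\<Sum>k. weight k * b j k)" for j
      by (intro suminf_nonneg summ mult_nonneg_nonneg weight_nonneg b01)
    have "(\<Sum>j\<in>J. \<Sum>k. weight k * b j k) = (\<Sum>k. \<Sum>j\<in>J. weight k * b j k)"
      by (rule suminf_sum[symmetric]) (rule summ)
    also have "\<dots> \<le> (\<Sum>k. weight k * 4)"
    proof (rule suminf_le)
      show "(\<Sum>j\<in>J. weight k * b j k) \<le> weight k * 4" for k
        using sum_b[of k] weight_nonneg[of k] by (simp add: sum_distrib_left[symmetric] mult_left_mono)
      show "summable (\<lambda>k. \<Sum>j\<in>J. weight k * b j k)" by (intro summable_sum summ)
    qed (intro summable_mult2 summable_weight)
    also have "\<dots> = 4 * suminf weight" by (simp add: suminf_mult2[OF summable_weight, symmetric])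
    finally show "(\<Sum>j\<in>J. \<Sum>k. weight k * b j k) \<le> 4 * suminf weight" .
  next
    fix j p q
    assume pq: "p \<in> unit_square" "q \<in> unit_square" "\<bar>fst p - fst q\<bar> \<le> \<delta>"
      "{snd p, snd q} \<subseteq> {of_int j * \<delta>..(of_int j + 1) * \<delta>}"
    have sp: "summable (\<lambda>k. weight k * bump k p)" "summable (\<lambda>k. weight k * bump k q)"
      using pq by (auto intro!: summable_bumps)
    have le: "\<bar>weight k * bump k p - weight k * bump k q\<bar> \<le> weight k * b j k" for k
      using bump_le[OF pq, of k] weight_nonneg[of k]
      by (simp add: right_diff_distrib[symmetric] abs_mult mult_left_mono)
    then have sd: "summable (\<lambda>k. \<bar>weight k * bump k p - weight k * bump k q\<bar>)"
      by (intro summable_comparison_test'[OF summ[of j], of 0]) auto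
    have "\<bar>bumps p - bumps q\<bar> = \<bar>\<Sum>k. weight k * bump k p - weight k * bump k q\<bar>"
      unfolding bumps_def by (subst suminf_diff[OF sp]) simp
    also have "\<dots> \<le> (\<Sum>k. \<bar>weight k * bump k p - weight k * bump k q\<bar>)"
      by (rule summable_rabs[OF sd])
    also have "\<dots> \<le> (\<Sum>k. weight k * b j k)" by (intro suminf_le le sd summ)
    finally show "\<bar>bumps p - bumps q\<bar> \<le> (\<Sum>k. weight k * b j k)" .
  qed
qed

lemma bumps_second_difference:
  fixes n i :: nat
  shows "2 * bumps ((i + 1 / 2) / 2 ^ n, 0) - bumps (i / 2 ^ n, 0) - bumps ((i + 1) / 2 ^ n, 0) = weight n"
proof -
  let ?x = "\<lambda>t k. weight k * bump k (t / 2 ^ n, 0)"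
  have s: "(?x t) sums bumps (t / 2 ^ n, 0)" for t
    unfolding bumps_def by (intro summable_sums summable_bumps) simp
  have "(\<lambda>k. 2 * ?x (i + 1 / 2) k - ?x i k - ?x (i + 1) k) sums
      (2 * bumps ((i + 1 / 2) / 2 ^ n, 0) - bumps (i / 2 ^ n, 0) - bumps ((i + 1) / 2 ^ n, 0))"
    by (intro sums_diff sums_mult s)
  moreover have "2 * ?x (i + 1 / 2) k - ?x i k - ?x (i + 1) k = (if k = n then weight k else 0)" for k
  proof -
    have "2 * ?x (i + 1 / 2) k - ?x i k - ?x (i + 1) k =
        weight k * (2 * tent (2 ^ k * ((i + 1 / 2) / 2 ^ n)) - tent (2 ^ k * (i / 2 ^ n)) - tent (2 ^ k * ((i + 1) / 2 ^ n)))"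
      by (simp add: bump_def algebra_simps)
    also have "\<dots> = (if k = n then weight k else 0)"
      by (simp only: tent_second_difference) simp
    finally show ?thesis .
  qed
  ultimately show ?thesis
    using sums_unique2 sums_single[of n weight] by (simp only:) blast
qed

section \<open>Compact sets in the space of surfaces\<close>

text \<open>A distance below the k-th truncation level forces the minimum in the k-th summand to be
  the norm itself.\<close>

lemma osc_norm_le_dist_dim:
  assumes "dist_dim \<alpha> f g < (1/2) ^ Suc k"
  shows "osc_norm (\<alpha> + 1 / real (Suc k)) (f - g) \<le> ennreal (dist_dim \<alpha> f g)"
proof -
  define t where "t k = enn2real (min (ennreal ((1/2) ^ Suc k)) (osc_norm (\<alpha> + 1 / real (Suc k)) (f - g)))" for k
  have t: "ennreal (t k) = min (ennreal ((1/2) ^ Suc k)) (osc_norm (\<alpha> + 1 / real (Suc k)) (f - g))" for k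
    unfolding t_def by (rule ennreal_enn2real) (simp add: min_less_iff_disj ennreal_less_top)
  have t_nonneg: "0 \<le> t k" for k by (simp add: t_def)
  have t_le: "t k \<le> (1/2) ^ Suc k" for k
    by (rule ennreal_le_iff[THEN iffD1]) (simp_all only: t min.cobounded1, simp)
  have "summable t"
    by (rule summable_comparison_test'[of "\<lambda>k. (1/2) ^ Suc k" 0])
       (use t_nonneg t_le in \<open>auto intro!: summable_mult summable_geometric\<close>)
  from sum_le_suminf[OF this, of "{k}"] t_nonneg have "t k \<le> suminf t" by simp
  then have le: "t k \<le> dist_dim \<alpha> f g" unfolding dist_dim_def t_def .
  then have "ennreal (t k) < ennreal ((1/2) ^ Suc k)"
    using assms t_nonneg[of k] by (intro ennreal_lessI) auto
  then have "osc_norm (\<alpha> + 1 / real (Suc k)) (f - g) = ennreal (t k)"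
    unfolding t by (simp add: min_def split: if_splits)
  then show ?thesis using le by (simp add: ennreal_leI)
qed

lemma abs_diff_le_dist_dim:
  assumes "dist_dim \<alpha> f g < 1 / 2" "p \<in> unit_square"
  shows "\<bar>f p - g p\<bar> \<le> dist_dim \<alpha> f g"
proof -
  have "ennreal \<bar>(f - g) p\<bar> \<le> (SUP p\<in>unit_square. ennreal \<bar>(f - g) p\<bar>)"
    using assms(2) by (rule SUP_upper)
  also have "\<dots> \<le> osc_norm (\<alpha> + 1 / real (Suc 0)) (f - g)"
    unfolding osc_norm_def by (rule add_increasing2) auto
  also have "\<dots> \<le> ennreal (dist_dim \<alpha> f g)"
    using assms(1) by (intro osc_norm_le_dist_dim) simp
  finally show ?thesis
    using Metric_space.nonneg[OF Metric_space_dist_dim] by (simp add: ennreal_le_iff)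
qed

text \<open>The net lies in \<open>K\<close>, hence in \<open>C_dim \<alpha>\<close>, so continuity
  and the dimension bound hold for its finitely many members and spread to all of
  \<open>K\<close>.\<close>

lemma compactin_C_dim_finite_net:
  assumes "compactin (C_dim_top \<alpha>) K" "0 < \<epsilon>"
  obtains F where "finite F" "F \<subseteq> K" "\<And>f. f \<in> K \<Longrightarrow> \<exists>g\<in>F. dist_dim \<alpha> f g < \<epsilon>"
proof -
  interpret Metric_space "C_dim \<alpha>" "dist_dim \<alpha>" by (rule Metric_space_dist_dim)
  have "mtotally_bounded K"
    using assms(1) unfolding C_dim_top_def by (rule compactin_imp_mtotally_bounded)
  from this[unfolded mtotally_bounded_def, rule_format, OF assms(2)]
  obtain F where "finite F" "F \<subseteq> K" "K \<subseteq> (\<Union>x\<in>F. mball x \<epsilon>)"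
    by (elim exE conjE)
  moreover have "\<exists>g\<in>F. dist_dim \<alpha> f g < \<epsilon>" if "f \<in> K" for f
  proof -
    have "f \<in> (\<Union>x\<in>F. mball x \<epsilon>)" using \<open>K \<subseteq> _\<close> that by (rule subsetD)
    then obtain g where "g \<in> F" "f \<in> mball g \<epsilon>" by (rule UN_E)
    then show ?thesis using commute[of g f] by (intro bexI[of _ g]) (simp_all only: in_mball)
  qed
  ultimately show thesis by (intro that)
qed

lemma topspace_C_dim_top: "topspace (C_dim_top \<alpha>) = C_dim \<alpha>"
  by (simp add: C_dim_top_def Metric_space.topspace_mtopology[OF Metric_space_dist_dim])

lemma compactin_C_dim_subset: "compactin (C_dim_top \<alpha>) K \<Longrightarrow> K \<subseteq> C_dim \<alpha>"
  using compactin_subset_topspace[of "C_dim_top \<alpha>" K] by (simp add: topspace_C_dim_top)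

lemma C_dim_continuous: "f \<in> C_dim \<alpha> \<Longrightarrow> continuous_on unit_square f"
  by (simp add: C_dim_def cont_funs_def)

lemma compact_unit_square: "compact unit_square"
  by (intro compact_Times compact_Icc)

lemma compactin_C_dim_bounded:
  assumes "compactin (C_dim_top \<alpha>) K"
  obtains B where "\<And>f p. f \<in> K \<Longrightarrow> p \<in> unit_square \<Longrightarrow> \<bar>f p\<bar> \<le> B"
proof -
  obtain F where F: "finite F" "F \<subseteq> K" "\<And>f. f \<in> K \<Longrightarrow> \<exists>g\<in>F. dist_dim \<alpha> f g < 1 / 2"
    using compactin_C_dim_finite_net[OF assms, of "1/2"] by auto
  have "\<forall>g\<in>F. bounded (g ` unit_square)"
    using F(2) compactin_C_dim_subset[OF assms]
    by (auto intro!: compact_imp_bounded compact_continuous_image compact_unit_square C_dim_continuous)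
  then have "bounded (\<Union>g\<in>F. g ` unit_square)" using F(1) by (intro bounded_UN) auto
  then obtain B where B: "\<And>g p. g \<in> F \<Longrightarrow> p \<in> unit_square \<Longrightarrow> \<bar>g p\<bar> \<le> B"
    unfolding bounded_iff by (force simp only: real_norm_def)
  have "\<bar>f p\<bar> \<le> B + 1 / 2" if fp: "f \<in> K" "p \<in> unit_square" for f p
  proof -
    obtain g where "g \<in> F" "dist_dim \<alpha> f g < 1 / 2" using F(3)[OF fp(1)] by blast
    then show ?thesis using B[of g p] abs_diff_le_dist_dim[of \<alpha> f g p] fp(2) by linarith
  qed
  then show thesis by (rule that)
qed

lemma compactin_C_dim_equicontinuous:
  assumes "compactin (C_dim_top \<alpha>) K" "0 < \<epsilon>"
  obtains \<delta> where "0 < \<delta>"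
    "\<And>f p q. f \<in> K \<Longrightarrow> p \<in> unit_square \<Longrightarrow> q \<in> unit_square \<Longrightarrow> dist p q < \<delta> \<Longrightarrow> \<bar>f p - f q\<bar> \<le> \<epsilon>"
proof -
  \<comment> \<open>\<open>1 / 2\<close> is the range in which the metric controls the sup norm;
    \<open>\<epsilon> / 3\<close> serves the passage from \<open>f\<close> to \<open>g\<close>, the
    modulus of \<open>g\<close>, and the way back.\<close>
  define e where "e = min (1 / 2) (\<epsilon> / 3)"
  have e: "0 < e" "e \<le> 1 / 2" "3 * e \<le> \<epsilon>" using assms(2) by (auto simp: e_def)
  obtain F where F: "finite F" "F \<subseteq> K" "\<And>f. f \<in> K \<Longrightarrow> \<exists>g\<in>F. dist_dim \<alpha> f g < e"
    using compactin_C_dim_finite_net[OF assms(1) e(1)] by auto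
  have "\<exists>d>0. \<forall>p\<in>unit_square. \<forall>q\<in>unit_square. dist p q < d \<longrightarrow> \<bar>g p - g q\<bar> < e" if "g \<in> F" for g
  proof -
    have "uniformly_continuous_on unit_square g"
      using that F(2) compactin_C_dim_subset[OF assms(1)]
      by (intro compact_uniformly_continuous C_dim_continuous compact_unit_square) auto
    then show ?thesis using e(1) unfolding uniformly_continuous_on_def dist_real_def
      by (metis dist_commute)
  qed
  then obtain d where d: "\<And>g. g \<in> F \<Longrightarrow> 0 < d g"
    "\<And>g p q. g \<in> F \<Longrightarrow> p \<in> unit_square \<Longrightarrow> q \<in> unit_square \<Longrightarrow> dist p q < d g \<Longrightarrow> \<bar>g p - g q\<bar> < e"
    by metis
  define \<delta> where "\<delta> = Min (insert 1 (d ` F))"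
  have "0 < \<delta>" using F(1) d(1) by (auto simp: \<delta>_def)
  moreover have "\<bar>f p - f q\<bar> \<le> \<epsilon>"
    if fpq: "f \<in> K" "p \<in> unit_square" "q \<in> unit_square" "dist p q < \<delta>" for f p q
  proof -
    obtain g where g: "g \<in> F" "dist_dim \<alpha> f g < e" using F(3)[OF fpq(1)] by blast
    then have "\<delta> \<le> d g" using F(1) by (simp add: \<delta>_def)
    then have "\<bar>g p - g q\<bar> < e" using fpq g(1) by (intro d(2)) auto
    moreover have "\<bar>f p - g p\<bar> < e" "\<bar>f q - g q\<bar> < e"
      using abs_diff_le_dist_dim[OF _ fpq(2), of \<alpha> f g] abs_diff_le_dist_dim[OF _ fpq(3), of \<alpha> f g] g(2) e(2)
      by linarith+
    ultimately show ?thesis using e(3) by linarith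
  qed
  ultimately show thesis by (rule that)
qed

text \<open>\<open>p\<close> is the least common vertical modulus of \<open>K\<close>. Splitting a
  segment makes it subadditive, which reduces continuity everywhere to smallness near 0, that is, to
  equicontinuity.\<close>

lemma compactin_C_dim_vertical_modulus:
  assumes "compactin (C_dim_top \<alpha>) K"
  obtains p :: "real \<Rightarrow> real" and B where "continuous_on UNIV p" "mono p" "\<And>y. y \<le> 0 \<Longrightarrow> p y = 0" "\<And>y. p y \<le> B"
    "\<And>f t r s. f \<in> K \<Longrightarrow> t \<in> {0..1} \<Longrightarrow> r \<in> {0..1} \<Longrightarrow> s \<in> {0..1} \<Longrightarrow> \<bar>f (t, r) - f (t, s)\<bar> \<le> p \<bar>r - s\<bar>"
proof -
  obtain B where B: "\<And>f p. f \<in> K \<Longrightarrow> p \<in> unit_square \<Longrightarrow> \<bar>f p\<bar> \<le> B"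
    using compactin_C_dim_bounded[OF assms] by blast
  \<comment> \<open>The inserted 0 keeps the supremum well defined and nonnegative even when
    \<open>K\<close> is empty.\<close>
  define A where "A y = insert 0 {\<bar>f (t, r) - f (t, s)\<bar> | f t r s. f \<in> K \<and> t \<in> {0..1} \<and> r \<in> {0..1} \<and> s \<in> {0..1} \<and> \<bar>r - s\<bar> \<le> y}" for y :: real
  define p where "p y = Sup (A (max 0 y))" for y
  have A_le: "a \<le> 2 * \<bar>B\<bar>" if "a \<in> A y" for a y
  proof -
    have "\<bar>f (t, r) - f (t, s)\<bar> \<le> 2 * \<bar>B\<bar>" if "f \<in> K" "t \<in> {0..1}" "r \<in> {0..1}" "s \<in> {0..1}" for f t r s
      using B[OF that(1), of "(t, r)"] B[OF that(1), of "(t, s)"] that by auto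
    then show ?thesis using that unfolding A_def by auto
  qed
  have bdd: "bdd_above (A y)" for y using A_le by (auto simp: bdd_above_def)
  have ne: "A y \<noteq> {}" for y by (simp add: A_def)
  have p_upper: "\<bar>f (t, r) - f (t, s)\<bar> \<le> p y"
    if "f \<in> K" "t \<in> {0..1}" "r \<in> {0..1}" "s \<in> {0..1}" "\<bar>r - s\<bar> \<le> max 0 y" for f t r s y
    unfolding p_def by (intro cSup_upper bdd) (use that in \<open>auto simp: A_def\<close>)
  have p_nonneg: "0 \<le> p y" for y
    unfolding p_def by (intro cSup_upper bdd) (auto simp: A_def)
  have p_least: "p y \<le> c" if "0 \<le> c"
    "\<And>f t r s. f \<in> K \<Longrightarrow> t \<in> {0..1} \<Longrightarrow> r \<in> {0..1} \<Longrightarrow> s \<in> {0..1} \<Longrightarrow> \<bar>r - s\<bar> \<le> max 0 y \<Longrightarrow> \<bar>f (t, r) - f (t, s)\<bar> \<le> c" for y c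
    unfolding p_def by (rule cSup_least[OF ne]) (use that in \<open>auto simp: A_def\<close>)
  have p_le: "p y \<le> 2 * \<bar>B\<bar>" for y
    unfolding p_def by (rule cSup_least[OF ne A_le])
  have p_0: "p y = 0" if "y \<le> 0" for y
    using p_nonneg[of y] p_least[of 0 y] that by (simp add: antisym max_absorb1)
  have mono: "mono p"
  proof (rule monoI)
    fix x y :: real assume "x \<le> y"
    then show "p x \<le> p y" by (intro p_least p_nonneg p_upper) auto
  qed
  have subadd: "p (y + h) \<le> p y + p h" if yh: "0 \<le> y" "0 \<le> h" for y h
  proof (rule p_least)
    show "0 \<le> p y + p h" using p_nonneg by (simp add: add_nonneg_nonneg)
    fix f and t r s :: real assume *: "f \<in> K" "t \<in> {0..1}" "r \<in> {0..1::real}" "s \<in> {0..1}" "\<bar>r - s\<bar> \<le> max 0 (y + h)"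
    \<comment> \<open>\<open>u\<close> lies between \<open>r\<close> and \<open>s\<close>, at
      distance \<open>y\<close> from \<open>r\<close> unless \<open>s\<close> is reached earlier;
      the rest of the way is at most \<open>h\<close>.\<close>
    define u where "u = (if r \<le> s then min s (r + y) else max s (r - y))"
    have u: "u \<in> {0..1}" "\<bar>r - u\<bar> \<le> max 0 y" "\<bar>u - s\<bar> \<le> max 0 h"
      using * yh by (auto simp: u_def)
    show "\<bar>f (t, r) - f (t, s)\<bar> \<le> p y + p h"
      using p_upper[OF *(1,2,3) u(1,2)] p_upper[OF *(1,2) u(1) *(4) u(3)] by linarith
  qed
  have diff: "p y - p x \<le> p (y - x)" if "x \<le> y" for x y
  proof (cases "0 \<le> x")
    case True
    then show ?thesis using subadd[of x "y - x"] that by simp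
  next
    case False
    then show ?thesis using monoD[OF mono, of y "y - x"] p_0[of x] by simp
  qed
  have "continuous_on UNIV p"
  proof (rule continuous_on_iff[THEN iffD2], intro ballI allI impI)
    fix x e :: real assume "0 < e"
    then obtain d where d: "0 < d" "\<And>f p q. f \<in> K \<Longrightarrow> p \<in> unit_square \<Longrightarrow> q \<in> unit_square \<Longrightarrow> dist p q < d \<Longrightarrow> \<bar>f p - f q\<bar> \<le> e / 2"
      using compactin_C_dim_equicontinuous[OF assms, of "e / 2"] by auto
    have small: "p y \<le> e / 2" if "y < d" for y
    proof (rule p_least)
      fix f and t r s :: real assume "f \<in> K" "t \<in> {0..1}" "r \<in> {0..1::real}" "s \<in> {0..1}" "\<bar>r - s\<bar> \<le> max 0 y"
      moreover have "dist (t, r) (t, s) = \<bar>r - s\<bar>" by (simp add: dist_Pair_Pair dist_real_def)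
      ultimately show "\<bar>f (t, r) - f (t, s)\<bar> \<le> e / 2"
        using d(1) that by (intro d(2)) auto
    qed (use \<open>0 < e\<close> in simp)
    have "\<bar>p y - p x\<bar> < e" if "\<bar>y - x\<bar> < d" for y
    proof (cases "x \<le> y")
      case True
      then show ?thesis using diff[of x y] small[of "y - x"] monoD[OF mono True] that \<open>0 < e\<close> by linarith
    next
      case False
      then have yx: "y \<le> x" by simp
      then show ?thesis using diff[of y x] small[of "x - y"] monoD[OF mono yx] that \<open>0 < e\<close> by linarith
    qed
    then show "\<exists>d>0. \<forall>x'\<in>UNIV. dist x' x < d \<longrightarrow> dist (p x') (p x) < e"
      using d(1) by (auto simp: dist_real_def)
  qed
  then show thesis by (rule that[OF _ mono p_0 p_le]) (simp_all add: p_upper)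
qed

section \<open>Admissible translations and the horizons they produce\<close>

definition zero_ext :: "(real \<times> real \<Rightarrow> real) \<Rightarrow> real \<times> real \<Rightarrow> real" where
  "zero_ext f p = (if p \<in> unit_square then f p else 0)"

text \<open>Members of \<open>C_dim\<close> must vanish off the square, hence
  \<open>zero_ext\<close>; inside, the graph is unchanged, and \<open>2 \<le> \<alpha>\<close>
  admits every surface of dimension at most 2.\<close>

lemma zero_ext_in_C_dim:
  assumes "continuous_on unit_square f" "rowwise_bounded C f" "2 \<le> \<alpha>"
  shows "zero_ext f \<in> C_dim \<alpha>"
proof -
  have "graph_on unit_square (zero_ext f) = graph_on unit_square f"
    unfolding graph_on_def by (rule image_cong) (auto simp: zero_ext_def)
  moreover have "upper_box_dim (graph_on unit_square f) \<le> ereal 2"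
    using assms(1,2) by (intro upper_box_dim_graph_rowwise_bounded compact_imp_bounded
      compact_continuous_image compact_unit_square)
  moreover have "continuous_on unit_square (zero_ext f)"
    using assms(1) by (rule continuous_on_cong[THEN iffD1, rotated 2]) (auto simp: zero_ext_def)
  ultimately show ?thesis
    using assms(3) by (auto simp: C_dim_def cont_funs_def zero_ext_def intro: order_trans)
qed

text \<open>If \<open>p\<close> dominates the vertical moduli of continuity of a family of functions, then subtracting
  \<open>ridge p y0\<close> moves all their vertical maxima to the line \<open>y = y0\<close>.\<close>

definition ridge :: "(real \<Rightarrow> real) \<Rightarrow> real \<Rightarrow> real \<times> real \<Rightarrow> real" where
  "ridge p y0 = (\<lambda>q. p \<bar>snd q - y0\<bar>)"

lemma continuous_on_ridge: "continuous_on UNIV p \<Longrightarrow> continuous_on A (ridge p y0)"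
  unfolding ridge_def by (rule continuous_on_compose2[of UNIV p]) (auto intro!: continuous_intros)

lemma rowwise_bounded_ridge:
  fixes p :: "real \<Rightarrow> real"
  assumes "mono p" "\<And>y. y \<le> 0 \<Longrightarrow> p y = 0" "\<And>y. p y \<le> B"
  shows "rowwise_bounded (2 * B) (ridge p y0)"
proof (rule rowwise_bounded_monotone)
  have nonneg: "0 \<le> p y" for y
    using monoD[OF assms(1), of "min 0 y" y] assms(2)[of "min 0 y"] by simp
  \<comment> \<open>The ridge falls and then rises; reversing the sign of the falling branch gives a
    monotone function with the same local variation and total increment at most
    \<open>2 * B\<close>.\<close>
  show "mono (\<lambda>y. p (y - y0) - p (y0 - y))"
    by (intro monoI diff_mono monoD[OF assms(1)]) auto
  show "(p (x - y0) - p (y0 - x)) - (p (y - y0) - p (y0 - y)) \<le> 2 * B" for x y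
    using nonneg[of "y0 - x"] nonneg[of "y - y0"] assms(3)[of "x - y0"] assms(3)[of "y0 - y"] by linarith
  \<comment> \<open>Since \<open>p\<close> vanishes on nonpositive arguments, at most one of the two
    terms is nonzero.\<close>
  have ridge: "ridge p y0 q = p (snd q - y0) + p (y0 - snd q)" for q
    using assms(2)[of "- \<bar>snd q - y0\<bar>"] by (cases "y0 \<le> snd q") (auto simp: ridge_def)
  fix q r :: "real \<times> real" assume le: "snd q \<le> snd r"
  have "p (snd q - y0) \<le> p (snd r - y0)" "p (y0 - snd r) \<le> p (y0 - snd q)"
    using le by (auto intro!: monoD[OF assms(1)])
  then show "\<bar>ridge p y0 q - ridge p y0 r\<bar>
      \<le> (p (snd r - y0) - p (y0 - snd r)) - (p (snd q - y0) - p (y0 - snd q))"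
    unfolding ridge by linarith
qed

lemma graph_on_horizon_eq:
  assumes "y0 \<in> {0..1}"
    "\<And>t y. t \<in> {0..1} \<Longrightarrow> y \<in> {0..1} \<Longrightarrow> g (t, y) \<le> g (t, y0)"
  shows "graph_on {0..1} (horizon g) = graph_on {0..1} (\<lambda>t. g (t, y0))"
  unfolding graph_on_def
proof (rule image_cong)
  fix t :: real assume t: "t \<in> {0..1}"
  have "(SUP y\<in>{0..1}. g (t, y)) = g (t, y0)"
    using assms t by (intro cSup_eq_maximum) auto
  then show "(t, horizon g t) = (t, g (t, y0))" using t by (simp add: horizon_def)
qed simp

text \<open>Columns over distinct mesh cubes consist of distinct cubes, so nothing is counted twice
  although neighbouring closed cubes share points.\<close>

lemma sum_mesh_count_le:
  fixes f :: "'a::euclidean_space \<Rightarrow> real"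
  assumes "0 < \<delta>" "bounded A" "bounded (f ` A)" "inj_on Q I" "\<And>i. i \<in> I \<Longrightarrow> Q i \<in> meeting_cubes \<delta> A"
  shows "(\<Sum>i\<in>I. mesh_count \<delta> (f ` (Q i \<inter> A))) \<le> mesh_count \<delta> (graph_on A f)"
proof -
  have "(\<Sum>i\<in>I. mesh_count \<delta> (f ` (Q i \<inter> A))) = (\<Sum>R\<in>Q ` I. mesh_count \<delta> (f ` (R \<inter> A)))"
    using assms(4) by (simp add: sum.reindex)
  also have "\<dots> \<le> (\<Sum>R\<in>meeting_cubes \<delta> A. mesh_count \<delta> (f ` (R \<inter> A)))"
    using assms by (intro sum_mono2 finite_meeting_cubes) auto
  finally show ?thesis using assms(1-3) by (simp add: mesh_count_graph_on)
qed

section \<open>Dyadic intervals and the dimension of a curve plus the trace of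
  \<open>bumps\<close>\<close>

definition dyadic :: "nat \<Rightarrow> nat \<Rightarrow> real set" where
  "dyadic n i = {real i / 2 ^ n .. (real i + 1) / 2 ^ n}"

lemma dyadic_eq: "dyadic n i = {of_int (int i) * (1/2) ^ n .. (of_int (int i) + 1) * (1/2) ^ n}"
  by (simp add: dyadic_def power_divide)

lemma dyadic_subset_unit:
  assumes "i < 2 ^ n" shows "dyadic n i \<subseteq> {0..1}"
proof -
  have "real (i + 1) \<le> real (2 ^ n)" using assms by (intro of_nat_mono) simp
  then have "(real i + 1) / 2 ^ n \<le> 1" by (simp add: divide_le_eq)
  then show ?thesis by (auto simp: dyadic_def intro: order_trans)
qed

lemma inj_dyadic: "inj (dyadic n)"
proof -
  have "dyadic n = (\<lambda>m::int. {of_int m * (1/2) ^ n .. (of_int m + 1) * (1/2) ^ n}) \<circ> int"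
    unfolding comp_def dyadic_eq ..
  then show ?thesis by (simp only:) (intro inj_compose inj_mesh_interval inj_of_nat, simp)
qed

lemma dyadic_nonempty: "dyadic n i \<noteq> {}"
  by (simp add: dyadic_def divide_right_mono)

lemma dyadic_meeting_cubes:
  assumes "i < 2 ^ n" shows "dyadic n i \<in> meeting_cubes ((1/2) ^ n) {0..1}"
proof -
  have "dyadic n i \<in> range (mesh_cube ((1/2) ^ n))"
    unfolding range_mesh_cube_real dyadic_eq by (rule rangeI)
  then show ?thesis
    using dyadic_subset_unit[OF assms] dyadic_nonempty[of n i] by (simp add: meeting_cubes_def inf.absorb1)
qed

lemma dyadic_oscillation_le:
  assumes "continuous_on {0..1} f" "i < 2 ^ n" "s \<in> dyadic n i" "t \<in> dyadic n i"
  shows "\<bar>f s - f t\<bar> \<le> (1/2) ^ n * mesh_count ((1/2) ^ n) (f ` (dyadic n i \<inter> {0..1}))"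
proof (rule mesh_count_ge)
  have eq: "dyadic n i \<inter> {0..1} = dyadic n i" using dyadic_subset_unit[OF assms(2)] by blast
  have cont: "continuous_on (dyadic n i) f"
    using assms(1) dyadic_subset_unit[OF assms(2)] by (rule continuous_on_subset)
  show "bounded (f ` (dyadic n i \<inter> {0..1}))" "connected (f ` (dyadic n i \<inter> {0..1}))"
    unfolding eq using cont
    by (auto simp: dyadic_def intro!: compact_imp_bounded compact_continuous_image connected_continuous_image)
qed (use assms dyadic_subset_unit[OF assms(2)] in auto)

lemma half_power_powr: "((1/2::real) ^ n) powr (- s) = 2 powr (s * n)"
proof -
  have "(1/2::real) ^ n = 2 powr (- real n)"
    by (simp add: powr_minus powr_realpow power_one_over inverse_eq_divide)
  then show ?thesis by (simp add: powr_powr mult.commute)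
qed

text \<open>Bounds on the upper dimension hold at all fine scales, so one \<open>n\<close> serves
  both curves. Their counts bound their oscillation sums, while each of the \<open>2 ^ n\<close>
  intervals demands \<open>weight n\<close>: this gives
  \<open>2 ^ n * weight n \<le> 4 * 2 powr ((s - 1) * n)\<close>, impossible for large
  \<open>n\<close> because \<open>s < 2\<close>.\<close>

lemma upper_box_dim_add_bumps:
  assumes "continuous_on {0..1} \<phi>" "upper_box_dim (graph_on {0..1} \<phi>) < 2"
  shows "\<not> upper_box_dim (graph_on {0..1} (\<lambda>t. \<phi> t + bumps (t, 0))) < 2"
proof
  define \<psi> where "\<psi> t = \<phi> t + bumps (t, 0)" for t
  assume "upper_box_dim (graph_on {0..1} (\<lambda>t. \<phi> t + bumps (t, 0))) < 2"
  with assms(2) have "max (upper_box_dim (graph_on {0..1} \<phi>)) (upper_box_dim (graph_on {0..1} \<psi>)) < ereal 2"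
    by (simp add: \<psi>_def[abs_def])
  from ereal_dense2[OF this] obtain s
    where "max (upper_box_dim (graph_on {0..1} \<phi>)) (upper_box_dim (graph_on {0..1} \<psi>)) < ereal s" and s: "s < 2"
    by auto
  then have "\<forall>\<^sub>F n in sequentially. mesh_count ((1/2) ^ n) (graph_on {0..1} \<phi>) \<le> ((1/2) ^ n) powr (- s)"
    "\<forall>\<^sub>F n in sequentially. mesh_count ((1/2) ^ n) (graph_on {0..1} \<psi>) \<le> ((1/2) ^ n) powr (- s)"
    by (simp_all add: eventually_half_power[OF upper_box_dim_less_eventually])
  moreover have "\<forall>\<^sub>F n in sequentially. 4 * (real (Suc n))\<^sup>2 < 2 powr ((2 - s) * n)"
    using s by real_asymp
  ultimately have "\<forall>\<^sub>F n in sequentially. False"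
  proof eventually_elim
    case (elim n)
    have cont: "continuous_on {0..1} \<psi>"
      unfolding \<psi>_def
      by (intro continuous_intros assms continuous_on_compose2[OF continuous_on_bumps]) auto
    let ?c = "\<lambda>f i. mesh_count ((1/2) ^ n) (f ` (dyadic n i \<inter> {0..1}))"
    have bdd: "bounded (\<phi> ` {0..1})" "bounded (\<psi> ` {0..1})"
      using assms(1) cont by (auto intro!: compact_imp_bounded compact_continuous_image)
    have step: "weight n \<le> 2 * ((1/2) ^ n * ?c \<phi> i) + 2 * ((1/2) ^ n * ?c \<psi> i)" if i: "i < 2 ^ n" for i
    proof -
      let ?l = "i / 2 ^ n" and ?m = "(i + 1 / 2) / 2 ^ n" and ?r = "(i + 1) / 2 ^ n :: real"
      have mem: "?l \<in> dyadic n i" "?m \<in> dyadic n i" "?r \<in> dyadic n i"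
        by (auto simp: dyadic_def divide_right_mono)
      note osc = dyadic_oscillation_le[OF assms(1) i mem(2) mem(1)] dyadic_oscillation_le[OF assms(1) i mem(2) mem(3)]
        dyadic_oscillation_le[OF cont i mem(2) mem(1)] dyadic_oscillation_le[OF cont i mem(2) mem(3)]
      \<comment> \<open>The second difference of \<open>a - b\<close> regroups as
        \<open>(a - c) + (a - e) - (b - d) - (b - f)\<close>, four differences from the
        midpoint.\<close>
      have bound: "w \<le> 2 * x + 2 * y"
        if "w = 2 * (a - b) - (c - d) - (e - f)" "\<bar>b - d\<bar> \<le> x" "\<bar>b - f\<bar> \<le> x" "\<bar>a - c\<bar> \<le> y" "\<bar>a - e\<bar> \<le> y"
        for a b c d e f w x y :: real using that by (smt (verit))
      have "weight n = 2 * (\<psi> ?m - \<phi> ?m) - (\<psi> ?l - \<phi> ?l) - (\<psi> ?r - \<phi> ?r)"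
        using bumps_second_difference[of i n] by (simp add: \<psi>_def)
      then show ?thesis using osc by (rule bound)
    qed
    have "2 ^ n * weight n = (\<Sum>i<(2::nat) ^ n. weight n)" by simp
    also have "\<dots> \<le> (\<Sum>i<2 ^ n. 2 * ((1/2) ^ n * ?c \<phi> i) + 2 * ((1/2) ^ n * ?c \<psi> i))"
      by (intro sum_mono step) auto
    also have "\<dots> = (1/2) ^ n * (2 * real (\<Sum>i<2 ^ n. ?c \<phi> i) + 2 * real (\<Sum>i<2 ^ n. ?c \<psi> i))"
      by (simp add: sum.distrib sum_distrib_left mult_ac distrib_left)
    also have "\<dots> \<le> (1/2) ^ n * (2 * ((1/2) ^ n) powr (- s) + 2 * ((1/2) ^ n) powr (- s))"
    proof (intro mult_left_mono add_mono)
      have "(\<Sum>i<2 ^ n. ?c f i) \<le> mesh_count ((1/2) ^ n) (graph_on {0..1} f)" if "bounded (f ` {0..1})" for f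
        using that by (intro sum_mesh_count_le dyadic_meeting_cubes inj_on_subset[OF inj_dyadic]) auto
      from this[OF bdd(1)] this[OF bdd(2)]
      show "real (\<Sum>i<2 ^ n. ?c \<phi> i) \<le> ((1/2) ^ n) powr (- s)" "real (\<Sum>i<2 ^ n. ?c \<psi> i) \<le> ((1/2) ^ n) powr (- s)"
        using elim(1,2) by linarith+
    qed auto
    finally have le: "2 ^ n * weight n \<le> (1/2) ^ n * (4 * ((1/2) ^ n) powr (- s))" by simp
    have "2 powr ((2 - s) * n) * 2 powr (s * n) = 2 powr (real n + real n)"
      by (simp add: powr_add[symmetric] algebra_simps)
    also have "\<dots> = 2 ^ n * 2 ^ n" unfolding powr_add by (simp add: powr_realpow)
    finally have "2 powr ((2 - s) * n) * weight n * 2 powr (s * n) = 2 ^ n * (2 ^ n * weight n)"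
      by (simp add: mult_ac)
    also have "\<dots> \<le> 2 ^ n * ((1/2) ^ n * (4 * 2 powr (s * n)))"
      using le unfolding half_power_powr by (intro mult_left_mono) auto
    also have "\<dots> = 4 * 2 powr (s * n)" by (simp add: power_one_over)
    finally have "2 powr ((2 - s) * n) * weight n \<le> 4" by simp
    then show False using elim(3) by (simp add: weight_def pos_divide_le_eq)
  qed
  then show False by simp
qed

section \<open>Oscillation sums and traces\<close>

text \<open>Only an inclusion: closed mesh squares with an index -1 can touch the unit square
  without belonging to the grid. The lower left corner is the common point.\<close>

lemma grid_squares_meeting_cubes:
  assumes "0 < \<delta>" shows "grid_squares \<delta> \<subseteq> meeting_cubes \<delta> unit_square"
proof
  fix S assume "S \<in> grid_squares \<delta>"
  then obtain n1 n2 :: int where n: "0 \<le> n1" "n1 \<le> \<lceil>1 / \<delta>\<rceil> - 1" "0 \<le> n2" "n2 \<le> \<lceil>1 / \<delta>\<rceil> - 1"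
    and S: "S = {of_int n1 * \<delta> .. (of_int n1 + 1) * \<delta>} \<times> {of_int n2 * \<delta> .. (of_int n2 + 1) * \<delta>}"
    unfolding grid_squares_def by blast
  have mem: "of_int m * \<delta> \<in> {0..1}" "of_int m * \<delta> \<in> {of_int m * \<delta> .. (of_int m + 1) * \<delta>}"
    if "0 \<le> m" "m \<le> \<lceil>1 / \<delta>\<rceil> - 1" for m :: int
  proof -
    have "of_int m \<le> 1 / \<delta>" using that(2) by linarith
    then show "of_int m * \<delta> \<in> {0..1}" using assms that(1) by (simp add: pos_le_divide_eq)
  qed (use assms in \<open>simp add: algebra_simps\<close>)
  have "(of_int n1 * \<delta>, of_int n2 * \<delta>) \<in> S \<inter> unit_square"
    unfolding S using mem[OF n(1,2)] mem[OF n(3,4)] by blast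
  moreover have "S \<in> range (mesh_cube \<delta>)"
    unfolding S range_mesh_cube_prod range_mesh_cube_real by blast
  ultimately show "S \<in> meeting_cubes \<delta> unit_square" by (auto simp: meeting_cubes_def)
qed

lemma sum_osc_le_mesh_count:
  assumes "continuous_on unit_square f" "0 < \<delta>"
  shows "(\<Sum>S\<in>grid_squares \<delta>. osc f S) \<le> ennreal (\<delta> * mesh_count \<delta> (graph_on unit_square f))"
proof -
  have bdd: "bounded (f ` unit_square)"
    using assms(1) by (intro compact_imp_bounded compact_continuous_image compact_unit_square)
  have osc: "osc f S \<le> ennreal (\<delta> * mesh_count \<delta> (f ` (S \<inter> unit_square)))" if S: "S \<in> grid_squares \<delta>" for S
    unfolding osc_def
  proof (intro SUP_least ennreal_leI mesh_count_ge assms(2))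
    show "bounded (f ` (S \<inter> unit_square))" by (rule bounded_subset[OF bdd]) auto
    have "convex S" using S unfolding grid_squares_def by (auto intro!: convex_Times)
    then have "connected (S \<inter> unit_square)"
      by (intro convex_connected convex_Int convex_Times) auto
    then show "connected (f ` (S \<inter> unit_square))"
      by (intro connected_continuous_image continuous_on_subset[OF assms(1)]) auto
  qed auto
  have "(\<Sum>S\<in>grid_squares \<delta>. osc f S) \<le> (\<Sum>S\<in>grid_squares \<delta>. ennreal (\<delta> * mesh_count \<delta> (f ` (S \<inter> unit_square))))"
    by (intro sum_mono osc)
  also have "\<dots> = ennreal (\<delta> * real (\<Sum>S\<in>grid_squares \<delta>. mesh_count \<delta> (f ` (S \<inter> unit_square))))"
    using assms(2) by (simp add: sum_ennreal sum_distrib_left)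
  also have "\<dots> \<le> ennreal (\<delta> * mesh_count \<delta> (graph_on unit_square f))"
  proof (intro ennreal_leI mult_left_mono of_nat_mono)
    show "(\<Sum>S\<in>grid_squares \<delta>. mesh_count \<delta> (f ` (S \<inter> unit_square))) \<le> mesh_count \<delta> (graph_on unit_square f)"
      using sum_mesh_count_le[of \<delta> unit_square f "\<lambda>S. S" "grid_squares \<delta>"]
        grid_squares_meeting_cubes[OF assms(2)] compact_imp_bounded[OF compact_unit_square] bdd assms(2)
      by (simp add: subset_eq)
  qed (use assms(2) in simp)
  finally show ?thesis .
qed

lemma C_dim_sum_osc:
  assumes "f \<in> C_dim \<alpha>" "0 < e"
  shows "\<forall>\<^sub>F n in sequentially. (\<Sum>S\<in>grid_squares ((1/2) ^ n). osc f S) \<le> ennreal (2 powr ((\<alpha> - 1 + e) * n))"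
proof -
  have "upper_box_dim (graph_on unit_square f) < ereal (\<alpha> + e)"
    using assms by (auto simp: C_dim_def intro: le_less_trans)
  from eventually_half_power[OF upper_box_dim_less_eventually[OF this]] show ?thesis
  proof eventually_elim
    case (elim n)
    have "(\<Sum>S\<in>grid_squares ((1/2) ^ n). osc f S) \<le>
        ennreal ((1/2) ^ n * mesh_count ((1/2) ^ n) (graph_on unit_square f))"
      by (intro sum_osc_le_mesh_count C_dim_continuous[OF assms(1)]) simp
    also have "\<dots> \<le> ennreal ((1/2) ^ n * 2 powr ((\<alpha> + e) * n))"
      using elim unfolding half_power_powr by (intro ennreal_leI mult_left_mono) auto
    also have "(1/2) ^ n * 2 powr ((\<alpha> + e) * n) = 2 powr ((\<alpha> - 1 + e) * n)"
      using half_power_powr[of n "-1"] by (simp add: powr_add[symmetric] algebra_simps)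
    finally show ?case .
  qed
qed

text \<open>Writing \<open>f = (f - g) + g\<close> with \<open>g\<close> in a finite net, the
  \<open>g\<close> part obeys its own dimension bound from some level on. The part
  \<open>f - g\<close> is controlled at all levels at once by the k-th norm, whose weight has the
  same exponent; hence the factor 2.\<close>

lemma compactin_C_dim_sum_osc:
  assumes "compactin (C_dim_top \<alpha>) K"
  shows "\<forall>\<^sub>F n in sequentially. \<forall>f\<in>K. (\<Sum>S\<in>grid_squares ((1/2) ^ n). osc f S)
    \<le> ennreal (2 * 2 powr ((\<alpha> - 1 + 1 / Suc k) * n))"
proof -
  \<comment> \<open>The radius is the truncation level of the k-th summand of the metric.\<close>
  obtain F where F: "finite F" "F \<subseteq> K" "\<And>f. f \<in> K \<Longrightarrow> \<exists>g\<in>F. dist_dim \<alpha> f g < (1/2) ^ Suc k"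
    using compactin_C_dim_finite_net[OF assms, of "(1/2) ^ Suc k"] by auto
  have "\<forall>\<^sub>F n in sequentially. \<forall>g\<in>F. (\<Sum>S\<in>grid_squares ((1/2) ^ n). osc g S) \<le> ennreal (2 powr ((\<alpha> - 1 + 1 / Suc k) * n))"
    using F(1,2) compactin_C_dim_subset[OF assms]
    by (intro eventually_ball_finite ballI C_dim_sum_osc) auto
  then show ?thesis
  proof eventually_elim
    case (elim n)
    show ?case
    proof
      fix f assume "f \<in> K"
      then obtain g where g: "g \<in> F" "dist_dim \<alpha> f g < (1/2) ^ Suc k" using F(3) by blast
      let ?\<delta> = "(1/2::real) ^ n" and ?s = "\<alpha> - 1 + 1 / Suc k"
      let ?X = "\<Sum>S\<in>grid_squares ?\<delta>. osc (f - g) S"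
      have "ennreal (?\<delta> powr (\<alpha> + 1 / Suc k - 1)) * ?X \<le> osc_norm (\<alpha> + 1 / Suc k) (f - g)"
        unfolding osc_norm_def
        by (rule add_increasing) (auto intro!: SUP_upper simp: power_le_one)
      also have "\<dots> \<le> ennreal (dist_dim \<alpha> f g)" using g(2) by (rule osc_norm_le_dist_dim)
      also have "\<dots> \<le> ennreal 1"
        using g(2) power_le_one[of "1/2::real" "Suc k"] by (intro ennreal_leI) simp
      finally have "ennreal (2 powr (?s * n)) * (ennreal (?\<delta> powr ?s) * ?X) \<le> ennreal (2 powr (?s * n)) * 1"
        by (intro mult_left_mono) (auto simp: algebra_simps)
      moreover have "2 powr (?s * n) * ?\<delta> powr ?s = 1"
        unfolding half_power_powr[symmetric] by (simp flip: powr_add)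
      ultimately have X: "?X \<le> ennreal (2 powr (?s * n))"
        by (simp add: mult.assoc[symmetric] ennreal_mult[symmetric])
      have "(\<Sum>S\<in>grid_squares ?\<delta>. osc f S) \<le> (\<Sum>S\<in>grid_squares ?\<delta>. osc (f - g) S + osc g S)"
        using osc_triangle[of f 0 _ g] by (intro sum_mono) simp
      also have "\<dots> \<le> ennreal (2 powr (?s * n)) + ennreal (2 powr (?s * n))"
        unfolding sum.distrib using elim g(1) by (intro add_mono X) auto
      also have "\<dots> = ennreal (2 * 2 powr (?s * n))" by (simp flip: ennreal_plus)
      finally show "(\<Sum>S\<in>grid_squares ?\<delta>. osc f S) \<le> ennreal (2 * 2 powr (?s * n))" .
    qed
  qed
qed

text \<open>Controls every trace \<open>f (\<cdot>, y)\<close> with \<open>y\<close> in the j-th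
  strip of level \<open>n\<close>.\<close>

definition row_osc :: "nat \<Rightarrow> nat \<Rightarrow> (real \<times> real \<Rightarrow> real) \<Rightarrow> ennreal" where
  "row_osc n j f = (\<Sum>i<2 ^ n. osc f (dyadic n i \<times> dyadic n j))"

lemma sum_row_osc: "(\<Sum>j<2 ^ n. row_osc n j f) = (\<Sum>S\<in>grid_squares ((1/2) ^ n). osc f S)"
proof -
  let ?A = "{..<(2::nat) ^ n} \<times> {..<(2::nat) ^ n}" and ?Q = "\<lambda>(i, j). dyadic n i \<times> dyadic n j"
  have c: "\<lceil>1 / (1/2::real) ^ n\<rceil> = 2 ^ n"
    by (simp add: power_one_over)
  have "grid_squares ((1/2) ^ n) = ?Q ` ?A"
  proof (intro equalityI subsetI)
    fix S assume "S \<in> grid_squares ((1/2) ^ n)"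
    then obtain n1 n2 :: int where n: "0 \<le> n1" "n1 \<le> 2 ^ n - 1" "0 \<le> n2" "n2 \<le> 2 ^ n - 1"
      and S: "S = {of_int n1 * (1/2) ^ n .. (of_int n1 + 1) * (1/2) ^ n} \<times> {of_int n2 * (1/2) ^ n .. (of_int n2 + 1) * (1/2) ^ n}"
      unfolding grid_squares_def c by blast
    have "S = ?Q (nat n1, nat n2)" unfolding S prod.case dyadic_eq using n by simp
    moreover have "nat n1 < 2 ^ n" "nat n2 < 2 ^ n" using n by (simp_all add: nat_less_iff)
    ultimately show "S \<in> ?Q ` ?A" by blast
  next
    fix S assume "S \<in> ?Q ` ?A"
    then obtain i j where ij: "i < 2 ^ n" "j < 2 ^ n" "S = dyadic n i \<times> dyadic n j" by auto
    then have "int i \<le> 2 ^ n - 1" "int j \<le> 2 ^ n - 1"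
      by (simp_all add: int_le_real_less)
    then show "S \<in> grid_squares ((1/2) ^ n)"
      unfolding grid_squares_def c ij(3) dyadic_eq
      by (intro CollectI exI[of _ "int i"] exI[of _ "int j"]) simp
  qed
  moreover have "inj_on ?Q ?A"
    using dyadic_nonempty inj_dyadic[of n] by (auto simp: inj_on_def times_eq_iff)
  ultimately have "(\<Sum>S\<in>grid_squares ((1/2) ^ n). osc f S) = (\<Sum>(i, j)\<in>?A. osc f (dyadic n i \<times> dyadic n j))"
    by (simp add: sum.reindex case_prod_unfold)
  also have "\<dots> = (\<Sum>i<2 ^ n. \<Sum>j<2 ^ n. osc f (dyadic n i \<times> dyadic n j))"
    by (simp add: sum.cartesian_product)
  also have "\<dots> = (\<Sum>j<2 ^ n. row_osc n j f)"
    unfolding row_osc_def by (rule sum.swap)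
  finally show ?thesis ..
qed

text \<open>\<open>osc\<close> is a supremum of the continuous functionals
  \<open>\<bar>f p - f q\<bar>\<close>, hence lower semicontinuous; this supplies its Borel
  measurability.\<close>

lemma openin_C_dim_osc_greater: "openin (C_dim_top \<alpha>) {f \<in> C_dim \<alpha>. y < osc f S}"
proof -
  interpret Metric_space "C_dim \<alpha>" "dist_dim \<alpha>" by (rule Metric_space_dist_dim)
  have "\<exists>r>0. mball f r \<subseteq> {f \<in> C_dim \<alpha>. y < osc f S}" if f: "f \<in> C_dim \<alpha>" "y < osc f S" for f
  proof -
    obtain p q where pq: "p \<in> S \<inter> unit_square" "q \<in> S \<inter> unit_square" "y < ennreal \<bar>f p - f q\<bar>"
      using f(2) unfolding osc_def less_SUP_iff by blast
    then have "y \<noteq> top" by auto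
    then obtain z where z: "0 \<le> z" "y = ennreal z" by (cases y) auto
    have less: "z < \<bar>f p - f q\<bar>" using pq(3) z by (simp add: ennreal_less_iff)
    \<comment> \<open>Half the gap, because both values \<open>f p\<close> and \<open>f q\<close>
      may move by almost \<open>r\<close>; \<open>1 / 2\<close> keeps the metric above the sup
      norm.\<close>
    define r where "r = min (1 / 2) ((\<bar>f p - f q\<bar> - z) / 2)"
    have "r \<le> (\<bar>f p - f q\<bar> - z) / 2" unfolding r_def by (rule min.cobounded2)
    then have "2 * r \<le> \<bar>f p - f q\<bar> - z" by (simp add: field_simps)
    moreover have "0 < r" "r \<le> 1 / 2" using less by (simp_all add: r_def)
    ultimately have r: "2 * r \<le> \<bar>f p - f q\<bar> - z" "0 < r" "r \<le> 1 / 2" by this+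
    have "y < osc g S" if g: "g \<in> mball f r" for g
    proof -
      have "dist_dim \<alpha> f g < r" using g by simp
      then have "\<bar>f p - g p\<bar> < r" "\<bar>f q - g q\<bar> < r"
        using abs_diff_le_dist_dim[of \<alpha> f g p] abs_diff_le_dist_dim[of \<alpha> f g q] r(3) pq(1,2) by auto
      then have "z < \<bar>g p - g q\<bar>" using r(1) by linarith
      then have "y < ennreal \<bar>g p - g q\<bar>" using z by (simp add: ennreal_less_iff)
      then show ?thesis unfolding osc_def less_SUP_iff using pq(1,2) by blast
    qed
    then show ?thesis using r(2) by (intro exI[of _ r]) auto
  qed
  then show ?thesis unfolding C_dim_top_def openin_mtopology by blast
qed

lemma borel_measurable_osc:
  assumes "space \<mu> = topspace (C_dim_top \<alpha>)" "sets \<mu> = sets (borel_of_top (C_dim_top \<alpha>))"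
  shows "(\<lambda>f. osc f S) \<in> borel_measurable \<mu>"
proof (rule borel_measurableI_greater)
  fix y
  have "{U. openin (C_dim_top \<alpha>) U} \<subseteq> Pow (topspace (C_dim_top \<alpha>))"
    by (auto dest: openin_subset)
  then show "{f \<in> space \<mu>. y < osc f S} \<in> sets \<mu>"
    unfolding assms borel_of_top_def topspace_C_dim_top
    by (simp add: openin_C_dim_osc_greater sigma_sets.Basic)
qed

lemma mesh_count_trace_le:
  fixes R :: real
  assumes "y \<in> dyadic n j" "j < 2 ^ n" "row_osc n j f \<le> ennreal R" "0 \<le> R"
    "bounded ((\<lambda>t. f (t, y)) ` {0..1})"
  shows "mesh_count ((1/2) ^ n) (graph_on {0..1} (\<lambda>t. f (t, y))) \<le> 2 * 2 ^ n * R + 2 * (2 ^ n + 2)"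
proof -
  define \<phi> where "\<phi> t = f (t, y)" for t
  let ?\<delta> = "(1/2::real) ^ n"
  define I where "I i = {of_int i * ?\<delta> .. (of_int i + 1) * ?\<delta>}" for i :: int
  define J where "J = {-1..2 ^ n :: int}"
  \<comment> \<open>The border intervals -1 and \<open>2 ^ n\<close> meet \<open>{0..1}\<close> in a
    single point only, so 0 is a valid oscillation bound there.\<close>
  define r where "r i = (if 0 \<le> i \<and> i < 2 ^ n then enn2real (osc f (dyadic n (nat i) \<times> dyadic n j)) else 0)" for i :: int
  have d: "0 < ?\<delta>" by simp
  have c: "\<lceil>1 / ?\<delta>\<rceil> = 2 ^ n"
    by (simp add: power_one_over)
  \<comment> \<open>\<open>enn2real\<close> sends infinity to 0; the bound on the row excludes
    this.\<close>
  have osc: "ennreal (enn2real (osc f (dyadic n i \<times> dyadic n j))) = osc f (dyadic n i \<times> dyadic n j)"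
    if "i < 2 ^ n" for i
  proof -
    have "osc f (dyadic n i \<times> dyadic n j) \<le> row_osc n j f"
      unfolding row_osc_def using that by (intro member_le_sum) auto
    then have "osc f (dyadic n i \<times> dyadic n j) < top"
      using assms(3) by (metis ennreal_less_top order_le_less_trans)
    then show ?thesis by simp
  qed
  have pow: "- 1 \<le> (2::int) ^ n" by (rule order_trans[of _ 0]) auto
  have J: "J = int ` {..<2 ^ n} \<union> {-1, 2 ^ n}"
  proof (intro equalityI subsetI)
    fix i assume "i \<in> J"
    then consider "i = -1" | "i = 2 ^ n" | "0 \<le> i" "i < 2 ^ n" unfolding J_def by fastforce
    then show "i \<in> int ` {..<2 ^ n} \<union> {-1, 2 ^ n}"
    proof cases
      case 3
      then have "i = int (nat i)" "nat i < 2 ^ n" by (simp_all add: nat_less_iff)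
      then show ?thesis by blast
    qed auto
  qed (auto simp: J_def pow)
  have card_J: "real (card J) = 2 ^ n + 2" unfolding J_def by (simp add: nat_add_distrib)
  have sum_r: "(\<Sum>i\<in>J. r i) \<le> R"
  proof -
    have "(\<Sum>i\<in>J. r i) = (\<Sum>i\<in>int ` {..<2 ^ n}. r i)"
      by (rule sum.mono_neutral_right) (auto simp: J r_def J_def)
    also have "\<dots> = (\<Sum>i<2 ^ n. enn2real (osc f (dyadic n i \<times> dyadic n j)))"
      by (subst sum.reindex) (auto simp: r_def intro!: sum.cong)
    finally have "ennreal (\<Sum>i\<in>J. r i) = row_osc n j f"
      unfolding row_osc_def by (simp add: sum_ennreal[symmetric] osc)
    then show ?thesis using assms(3,4) by (metis ennreal_le_iff)
  qed
  have count: "real (mesh_count ?\<delta> (\<phi> ` (I i \<inter> {0..1}))) \<le> 2 * r i / ?\<delta> + 2" for i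
  proof (rule mesh_count_le[OF d])
    show "0 \<le> r i" by (simp add: r_def)
    fix a b assume "a \<in> \<phi> ` (I i \<inter> {0..1})" "b \<in> \<phi> ` (I i \<inter> {0..1})"
    then obtain s t where st: "a = \<phi> s" "b = \<phi> t" "s \<in> I i" "t \<in> I i" "s \<in> {0..1}" "t \<in> {0..1}" by blast
    show "\<bar>a - b\<bar> \<le> r i"
    proof (cases "0 \<le> i \<and> i < 2 ^ n")
      case True
      then have eq: "I i = dyadic n (nat i)" by (simp add: I_def dyadic_eq)
      have "y \<in> {0..1}" using assms(1) dyadic_subset_unit[OF assms(2)] by blast
      then have "ennreal \<bar>a - b\<bar> \<le> osc f (dyadic n (nat i) \<times> dyadic n j)"
        unfolding osc_def st(1,2) \<phi>_def using st assms(1) eq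
        by (intro SUP_upper2[of "(s, y)"] SUP_upper2[of "(t, y)"]) auto
      also have "\<dots> = ennreal (r i)" using True osc[of "nat i"] by (simp add: r_def nat_less_iff)
      finally show ?thesis using \<open>0 \<le> r i\<close> by simp
    next
      case outside: False
      have "s = t"
      proof (cases "i < 0")
        case True
        then have "(of_int i + 1) * ?\<delta> \<le> 0" by (intro mult_nonpos_nonneg) auto
        then show ?thesis using st by (auto simp: I_def)
      next
        case False
        with outside have "2 ^ n \<le> i" by simp
        then have "real_of_int (2 ^ n) \<le> of_int i" by (simp only: of_int_le_iff)
        then have "1 \<le> of_int i * ?\<delta>" by (simp add: power_one_over divide_simps)
        then show ?thesis using st by (auto simp: I_def)
      qed
      then show ?thesis using st \<open>0 \<le> r i\<close> by simp
    qed
  qed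
  have sub: "meeting_cubes ?\<delta> {0..1} \<subseteq> I ` J"
  proof
    fix Q assume "Q \<in> meeting_cubes ?\<delta> {0..1::real}"
    then obtain i where i: "Q = I i" "I i \<inter> {0..1} \<noteq> {}"
      unfolding meeting_cubes_def range_mesh_cube_real I_def by blast
    have "i \<in> J" using mesh_interval_meets_unit[OF d i(2)[unfolded I_def]] unfolding c J_def .
    then show "Q \<in> I ` J" using i(1) by blast
  qed
  have "real (mesh_count ?\<delta> (graph_on {0..1} \<phi>)) = (\<Sum>Q\<in>meeting_cubes ?\<delta> {0..1}. real (mesh_count ?\<delta> (\<phi> ` (Q \<inter> {0..1}))))"
    using assms(5) unfolding \<phi>_def by (subst mesh_count_graph_on) auto
  also have "\<dots> \<le> (\<Sum>Q\<in>I ` J. real (mesh_count ?\<delta> (\<phi> ` (Q \<inter> {0..1}))))"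
    using sub by (intro sum_mono2) (auto simp: J_def)
  also have "\<dots> \<le> (\<Sum>i\<in>J. real (mesh_count ?\<delta> (\<phi> ` (I i \<inter> {0..1}))))"
    by (rule order_trans[OF sum_image_le]) (auto simp: J_def)
  also have "\<dots> \<le> (\<Sum>i\<in>J. 2 * r i / ?\<delta> + 2)" by (intro sum_mono count)
  also have "\<dots> = 2 * 2 ^ n * (\<Sum>i\<in>J. r i) + 2 * card J"
    by (simp add: sum.distrib power_one_over mult_ac sum_distrib_right)
  also have "\<dots> \<le> 2 * 2 ^ n * R + 2 * (2 ^ n + 2)"
    using sum_r by (intro add_mono mult_left_mono) (auto simp: card_J)
  finally show ?thesis by (simp add: \<phi>_def[abs_def])
qed

section \<open>Non-prevalence\<close>

text \<open>The oscillation sums are uniformly bounded on the compact set \<open>K\<close>. Integrating them over \<open>K\<close> and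
  averaging over the rows of each dyadic level replaces an application of Fubini's theorem on
  \<open>K \<times> [0, 1]\<close>, so no joint measurability is needed. The extra factor \<open>2 powr (- e * n)\<close> makes the
  series over the levels converge.\<close>

lemma AE_row_osc_bounded:
  fixes \<mu> :: "(real \<times> real \<Rightarrow> real) measure"
  assumes "space \<mu> = topspace (C_dim_top \<alpha>)" "sets \<mu> = sets (borel_of_top (C_dim_top \<alpha>))"
    and "compactin (C_dim_top \<alpha>) K" "K \<in> sets \<mu>" "emeasure \<mu> K < \<infinity>"
  shows "AE y in lborel. \<exists>N. \<forall>j. (\<forall>n. j n < 2 ^ n \<and> y \<in> dyadic n (j n)) \<longrightarrow>
    (AE f in \<mu>. f \<in> K \<longrightarrow> (\<exists>b\<ge>0. \<forall>n\<ge>N. row_osc n (j n) f \<le> ennreal (b * 2 powr ((\<alpha> - 2 + 2 / Suc k) * n))))"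
proof -
  define e where "e = 1 / real (Suc k)"
  have e: "0 < e" by (simp add: e_def)
  define c where "c n j = (\<integral>\<^sup>+f. row_osc n j f * indicator K f \<partial>\<mu>)" for n j
  \<comment> \<open>Up to dyadic endpoints, where two closed rows meet, this is the
    \<open>K\<close>-integral of the row through \<open>y\<close>.\<close>
  define h where "h n y = (\<Sum>j<2 ^ n. c n j * indicator (dyadic n j) y)" for n and y :: real
  \<comment> \<open>The exponent is \<open>\<alpha> - 1 + e\<close> from the oscillation sums, minus
    1 for the row height, plus a second \<open>e\<close> for the decay.\<close>
  define w where "w n = ennreal (2 powr (- (\<alpha> - 2 + 2 * e) * n))" for n :: nat
  have meas [measurable]: "row_osc n j \<in> borel_measurable \<mu>" for n j
    unfolding row_osc_def[abs_def] by (intro borel_measurable_sum borel_measurable_osc[OF assms(1,2)])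
  note assms(4)[measurable]
  have dy [measurable]: "dyadic n j \<in> sets lborel" for n j by (simp add: dyadic_def)
  have h_meas [measurable]: "h n \<in> borel_measurable lborel" for n
    unfolding h_def[abs_def] by measurable
  obtain N where N: "\<And>n f. N \<le> n \<Longrightarrow> f \<in> K \<Longrightarrow>
      (\<Sum>S\<in>grid_squares ((1/2) ^ n). osc f S) \<le> ennreal (2 * 2 powr ((\<alpha> - 1 + e) * n))"
    using compactin_C_dim_sum_osc[OF assms(3), of k] unfolding eventually_sequentially e_def by blast
  have h_int: "w n * (\<integral>\<^sup>+y. h n y \<partial>lborel) \<le> ennreal (2 * (2 powr - e) ^ n) * emeasure \<mu> K" if "N \<le> n" for n
  proof -
    have "(\<integral>\<^sup>+y. h n y \<partial>lborel) = (\<Sum>j<2 ^ n. \<integral>\<^sup>+y. c n j * indicator (dyadic n j) y \<partial>lborel)"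
      unfolding h_def by (rule nn_integral_sum) simp
    also have "\<dots> = (\<Sum>j<2 ^ n. c n j * emeasure lborel (dyadic n j))"
      by (simp only: nn_integral_cmult_indicator dy)
    also have "\<dots> = (\<Sum>j<2 ^ n. c n j) * ennreal ((1/2) ^ n)"
      by (simp add: dyadic_def add_divide_distrib divide_right_mono power_one_over sum_distrib_right)
    finally have h: "(\<integral>\<^sup>+y. h n y \<partial>lborel) = (\<Sum>j<2 ^ n. c n j) * ennreal ((1/2) ^ n)" .
    have "(\<Sum>j<2 ^ n. c n j) = (\<integral>\<^sup>+f. (\<Sum>j<2 ^ n. row_osc n j f) * indicator K f \<partial>\<mu>)"
      unfolding c_def sum_distrib_right by (rule nn_integral_sum[symmetric]) measurable
    also have "\<dots> \<le> (\<integral>\<^sup>+f. ennreal (2 * 2 powr ((\<alpha> - 1 + e) * n)) * indicator K f \<partial>\<mu>)"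
      unfolding sum_row_osc using N[OF that] by (intro nn_integral_mono) (auto simp: indicator_def)
    also have "\<dots> = ennreal (2 * 2 powr ((\<alpha> - 1 + e) * n)) * emeasure \<mu> K"
      by (rule nn_integral_cmult_indicator) fact
    finally have "w n * (\<integral>\<^sup>+y. h n y \<partial>lborel) \<le>
        w n * (ennreal (2 * 2 powr ((\<alpha> - 1 + e) * n)) * emeasure \<mu> K * ennreal ((1/2) ^ n))"
      unfolding h by (intro mult_left_mono mult_right_mono) auto
    also have "\<dots> = ennreal (2 powr (- (\<alpha> - 2 + 2 * e) * n) * (2 * 2 powr ((\<alpha> - 1 + e) * n)) * (1/2) ^ n) * emeasure \<mu> K"
      unfolding w_def by (simp add: ennreal_mult mult_ac)
    also have "2 powr (- (\<alpha> - 2 + 2 * e) * n) * (2 * 2 powr ((\<alpha> - 1 + e) * n)) * (1/2) ^ n = 2 * (2 powr - e) ^ n"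
    proof -
      have "(1/2 :: real) ^ n = 2 powr (- real n)" using half_power_powr[of n "-1"] by simp
      moreover have "(2 powr - e) ^ n = 2 powr (- e * n)"
        by (subst powr_realpow[symmetric]) (simp_all add: powr_powr)
      moreover have "- (\<alpha> - 2 + 2 * e) * n + (\<alpha> - 1 + e) * n + (- real n) = - e * n"
        by (simp add: algebra_simps)
      ultimately show ?thesis by (simp add: powr_add[symmetric] add_diff_eq)
    qed
    finally show ?thesis .
  qed
  have "(\<integral>\<^sup>+y. (\<Sum>n. w (n + N) * h (n + N) y) \<partial>lborel) = (\<Sum>n. w (n + N) * (\<integral>\<^sup>+y. h (n + N) y \<partial>lborel))"
    by (simp add: nn_integral_suminf nn_integral_cmult)
  also have "\<dots> \<le> (\<Sum>n. ennreal (2 * (2 powr - e) ^ (n + N)) * emeasure \<mu> K)"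
    by (intro suminf_le h_int) auto
  also have "\<dots> = (\<Sum>n. ennreal (2 * (2 powr - e) ^ (n + N))) * emeasure \<mu> K"
    by simp
  also have "\<dots> < \<infinity>"
  proof -
    have "2 powr - e < 1" using e by (simp add: powr_minus_divide)
    then have "summable (\<lambda>n. 2 * (2 powr - e) ^ (n + N))"
      by (intro summable_mult) (simp add: summable_iff_shift[of "\<lambda>n. (2 powr - e) ^ n"] summable_geometric)
    then have "(\<Sum>n. ennreal (2 * (2 powr - e) ^ (n + N))) \<noteq> top"
      by (intro ennreal_suminf_neq_top) auto
    then show ?thesis using assms(5) by (simp add: ennreal_mult_less_top top.not_eq_extremum)
  qed
  finally have "AE y in lborel. (\<Sum>n. w (n + N) * h (n + N) y) \<noteq> \<infinity>"
    by (intro nn_integral_noteq_infinite) auto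
  then show ?thesis
  proof eventually_elim
    case (elim y)
    show ?case
    proof (intro exI[of _ N] allI impI)
      fix j assume j: "\<forall>n. j n < 2 ^ n \<and> y \<in> dyadic n (j n)"
      have c_le: "c n (j n) \<le> h n y" for n
      proof -
        have "c n (j n) * indicator (dyadic n (j n)) y \<le> h n y"
          unfolding h_def using j by (intro member_le_sum) auto
        then show ?thesis using j by simp
      qed
      \<comment> \<open>Now \<open>y\<close> is fixed and the same weighted series is integrated
        over \<open>f\<close>; its finiteness bounds each term, with a constant depending on
        \<open>f\<close>.\<close>
      let ?g = "\<lambda>f. \<Sum>n. w (n + N) * (row_osc (n + N) (j (n + N)) f * indicator K f)"
      have "(\<integral>\<^sup>+f. ?g f \<partial>\<mu>) = (\<Sum>n. w (n + N) * c (n + N) (j (n + N)))"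
        unfolding c_def by (simp add: nn_integral_suminf nn_integral_cmult)
      also have "\<dots> \<le> (\<Sum>n. w (n + N) * h (n + N) y)"
        by (intro suminf_le mult_left_mono c_le) auto
      also have "\<dots> < \<infinity>" using elim by (simp add: less_top)
      finally have "AE f in \<mu>. ?g f \<noteq> \<infinity>"
        by (intro nn_integral_noteq_infinite) auto
      then show "AE f in \<mu>. f \<in> K \<longrightarrow>
          (\<exists>b\<ge>0. \<forall>n\<ge>N. row_osc n (j n) f \<le> ennreal (b * 2 powr ((\<alpha> - 2 + 2 / Suc k) * n)))"
      proof eventually_elim
        case (elim f)
        show ?case
        proof
          assume f: "f \<in> K"
          obtain b where b: "0 \<le> b" "?g f = ennreal b" using elim by (cases "?g f") auto
          have "row_osc n (j n) f \<le> ennreal (b * 2 powr ((\<alpha> - 2 + 2 * e) * n))" if n: "N \<le> n" for n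
          proof -
            have "w (n - N + N) * (row_osc (n - N + N) (j (n - N + N)) f * indicator K f) \<le> ?g f"
              using sum_le_suminf[of "\<lambda>n. w (n + N) * (row_osc (n + N) (j (n + N)) f * indicator K f)" "{n - N}"] by simp
            then have "w n * row_osc n (j n) f \<le> ennreal b" unfolding b(2) using n f by simp
            then have "ennreal (2 powr ((\<alpha> - 2 + 2 * e) * n)) * (w n * row_osc n (j n) f) \<le>
                ennreal (2 powr ((\<alpha> - 2 + 2 * e) * n)) * ennreal b"
              by (intro mult_left_mono) auto
            moreover have "ennreal (2 powr ((\<alpha> - 2 + 2 * e) * n)) * w n = 1"
              unfolding w_def by (simp add: ennreal_mult[symmetric] powr_add[symmetric] algebra_simps)
            ultimately show ?thesis
              using b(1) by (simp only: mult.assoc[symmetric] mult_1 ennreal_mult[symmetric] powr_ge_zero mult.commute[of b])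
          qed
          then show "\<exists>b\<ge>0. \<forall>n\<ge>N. row_osc n (j n) f \<le> ennreal (b * 2 powr ((\<alpha> - 2 + 2 / Suc k) * n))"
            using b(1) by (intro exI[of _ b]) (simp add: e_def)
        qed
      qed
    qed
  qed
qed

lemma lower_box_dim_trace_le:
  assumes "continuous_on unit_square f" "2 \<le> \<alpha>" "0 \<le> e" "0 \<le> b"
    "\<And>n. j n < 2 ^ n" "\<And>n. y \<in> dyadic n (j n)"
    "\<And>n. N \<le> n \<Longrightarrow> row_osc n (j n) f \<le> ennreal (b * 2 powr ((\<alpha> - 2 + e) * n))"
  shows "lower_box_dim (graph_on {0..1} (\<lambda>t. f (t, y))) \<le> ereal (\<alpha> - 1 + e)"
proof (rule lower_box_dim_leI)
  have y: "y \<in> {0..1}" using assms(5,6) dyadic_subset_unit by blast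
  have bdd: "bounded ((\<lambda>t. f (t, y)) ` {0..1})"
  proof (rule bounded_subset)
    show "bounded (f ` unit_square)"
      using assms(1) by (intro compact_imp_bounded compact_continuous_image compact_unit_square)
  qed (use y in auto)
  \<comment> \<open>\<open>2 * b\<close> comes from the row oscillation and 6 from
    \<open>2 * (2 ^ n + 2) \<le> 6 * 2 ^ n\<close>; by \<open>2 \<le> \<alpha>\<close> the latter is
    absorbed in the target power.\<close>
  show "0 < 2 * b + 6" "0 \<le> \<alpha> - 1 + e" using assms by auto
  show "\<forall>\<^sub>F n in sequentially. mesh_count ((1/2) ^ n) (graph_on {0..1} (\<lambda>t. f (t, y)))
      \<le> (2 * b + 6) * 2 powr ((\<alpha> - 1 + e) * n)"
    using eventually_ge_at_top[of N]
  proof eventually_elim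
    case (elim n)
    have "2 ^ n * 2 powr ((\<alpha> - 2 + e) * n) = 2 powr (n + (\<alpha> - 2 + e) * n)"
      by (simp add: powr_add powr_realpow)
    also have "\<dots> = 2 powr ((\<alpha> - 1 + e) * n)" by (simp add: algebra_simps)
    finally have eq: "2 ^ n * 2 powr ((\<alpha> - 2 + e) * n) = 2 powr ((\<alpha> - 1 + e) * n)" .
    have "1 * real n \<le> (\<alpha> - 1 + e) * n" using assms by (intro mult_right_mono) auto
    then have "2 powr real n \<le> 2 powr ((\<alpha> - 1 + e) * n)" by simp
    then have le: "2 ^ n \<le> 2 powr ((\<alpha> - 1 + e) * n)" by (simp add: powr_realpow)
    have one: "1 \<le> (2::real) ^ n" by simp
    have "mesh_count ((1/2) ^ n) (graph_on {0..1} (\<lambda>t. f (t, y)))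
        \<le> 2 * 2 ^ n * (b * 2 powr ((\<alpha> - 2 + e) * n)) + 2 * (2 ^ n + 2)"
      using assms elim by (intro mesh_count_trace_le bdd) auto
    also have "\<dots> = 2 * b * (2 ^ n * 2 powr ((\<alpha> - 2 + e) * n)) + 2 * (2 ^ n + 2)" by simp
    also have "\<dots> \<le> 2 * b * 2 powr ((\<alpha> - 1 + e) * n) + 6 * 2 powr ((\<alpha> - 1 + e) * n)"
      unfolding eq using le one by (smt (verit))
    finally show ?case by (simp add: algebra_simps)
  qed
qed

lemma dyadic_cover:
  assumes "y \<in> {0..1}" obtains j where "j < 2 ^ n" "y \<in> dyadic n j"
\<comment> \<open>The floor of \<open>y * 2 ^ n\<close> would give the inadmissible index
  \<open>2 ^ n\<close> here.\<close>
proof (cases "y = 1")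
  case True
  have "real (2 ^ n - 1) + 1 = 2 ^ n" by (simp add: of_nat_diff)
  then have "1 \<in> dyadic n (2 ^ n - 1)" by (simp add: dyadic_def field_simps)
  then show thesis using True by (intro that[of "2 ^ n - 1"]) auto
next
  case False
  define j where "j = nat \<lfloor>y * 2 ^ n\<rfloor>"
  have 0: "0 \<le> y * 2 ^ n" "y * 2 ^ n < 2 ^ n" using assms False by auto
  then have j: "real j \<le> y * 2 ^ n" "y * 2 ^ n < real j + 1" by (auto simp: j_def)
  have "real j < 2 ^ n" using j(1) 0(2) by linarith
  then have "j < 2 ^ n" by simp
  moreover have "y \<in> dyadic n j" using j by (simp add: dyadic_def field_simps)
  ultimately show thesis by (rule that)
qed

text \<open>Only countably many exponents \<open>2 / Suc k\<close> occur, so the exceptional sets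
  unite to null sets, first in \<open>y\<close> and then in \<open>f\<close>; \<open>{0..1}\<close>
  has positive measure and supplies one \<open>y\<close> for almost all \<open>f\<close> in
  \<open>K\<close>.\<close>

lemma AE_trace_lower_box_dim:
  assumes "space \<mu> = topspace (C_dim_top \<alpha>)" "sets \<mu> = sets (borel_of_top (C_dim_top \<alpha>))"
    and "compactin (C_dim_top \<alpha>) K" "K \<in> sets \<mu>" "emeasure \<mu> K < \<infinity>" "2 \<le> \<alpha>"
  obtains y where "y \<in> {0..1}"
    "AE f in \<mu>. f \<in> K \<longrightarrow> lower_box_dim (graph_on {0..1} (\<lambda>t. f (t, y))) \<le> ereal (\<alpha> - 1)"
proof -
  let ?P = "\<lambda>k y. \<exists>N. \<forall>j. (\<forall>n. j n < 2 ^ n \<and> y \<in> dyadic n (j n)) \<longrightarrow>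
    (AE f in \<mu>. f \<in> K \<longrightarrow> (\<exists>b\<ge>0. \<forall>n\<ge>N. row_osc n (j n) f \<le> ennreal (b * 2 powr ((\<alpha> - 2 + 2 / Suc k) * n))))"
  have AE: "AE y in lborel. \<forall>k. ?P k y"
    unfolding AE_all_countable using AE_row_osc_bounded[OF assms(1-5)] by blast
  have "\<exists>y\<in>{0..1}. \<forall>k. ?P k y"
  proof (rule ccontr)
    assume no: "\<not> ?thesis"
    have "AE y in lborel. y \<notin> {0..1::real}" using AE by eventually_elim (use no in blast)
    then have "{0..1::real} \<in> null_sets lborel" by (subst AE_iff_null_sets) auto
    then show False by (simp add: null_sets_def)
  qed
  then obtain y where y: "y \<in> {0..1}" "\<And>k. ?P k y" by blast
  have "\<exists>j. j < 2 ^ n \<and> y \<in> dyadic n j" for n using dyadic_cover[OF y(1)] by blast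
  then obtain j where j: "\<And>n. j n < 2 ^ n" "\<And>n. y \<in> dyadic n (j n)" by metis
  have "AE f in \<mu>. \<forall>k. f \<in> K \<longrightarrow> (\<exists>N. \<exists>b\<ge>0. \<forall>n\<ge>N. row_osc n (j n) f \<le> ennreal (b * 2 powr ((\<alpha> - 2 + 2 / Suc k) * n)))"
    unfolding AE_all_countable
  proof
    fix k
    obtain N where N: "AE f in \<mu>. f \<in> K \<longrightarrow> (\<exists>b\<ge>0. \<forall>n\<ge>N. row_osc n (j n) f \<le> ennreal (b * 2 powr ((\<alpha> - 2 + 2 / Suc k) * n)))"
      using y(2)[of k] j by blast
    then show "AE f in \<mu>. f \<in> K \<longrightarrow> (\<exists>N. \<exists>b\<ge>0. \<forall>n\<ge>N. row_osc n (j n) f \<le> ennreal (b * 2 powr ((\<alpha> - 2 + 2 / Suc k) * n)))"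
      by eventually_elim blast
  qed
  then have "AE f in \<mu>. f \<in> K \<longrightarrow> lower_box_dim (graph_on {0..1} (\<lambda>t. f (t, y))) \<le> ereal (\<alpha> - 1)"
  proof eventually_elim
    case (elim f)
    show ?case
    proof
      assume f: "f \<in> K"
      then have cont: "continuous_on unit_square f"
        using compactin_C_dim_subset[OF assms(3)] C_dim_continuous by blast
      have le: "lower_box_dim (graph_on {0..1} (\<lambda>t. f (t, y))) \<le> ereal (\<alpha> - 1 + 2 / Suc k)" for k
      proof -
        obtain N b where "b \<ge> 0" "\<And>n. N \<le> n \<Longrightarrow> row_osc n (j n) f \<le> ennreal (b * 2 powr ((\<alpha> - 2 + 2 / Suc k) * n))"
          using elim f by blast
        then show ?thesis using cont assms(6) j by (intro lower_box_dim_trace_le[where j = j and N = N and b = b]) auto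
      qed
      show "lower_box_dim (graph_on {0..1} (\<lambda>t. f (t, y))) \<le> ereal (\<alpha> - 1)"
      proof (rule ereal_le_epsilon2)
        fix \<epsilon> :: real assume "0 < \<epsilon>"
        then obtain k where "1 / real (Suc k) < \<epsilon> / 2" using nat_approx_posE[of "\<epsilon> / 2"] by auto
        then have "\<alpha> - 1 + 2 / Suc k \<le> \<alpha> - 1 + \<epsilon>" by simp
        then show "lower_box_dim (graph_on {0..1} (\<lambda>t. f (t, y))) \<le> ereal (\<alpha> - 1) + ereal \<epsilon>"
          using le[of k] by (metis ereal_less_eq(3) order_trans plus_ereal.simps(1))
      qed
    qed
  qed
  with y(1) show thesis by (rule that)
qed

section \<open>Consequences of prevalence and the two refutations\<close>

lemma mem_translate_iff: "f \<in> (\<lambda>f. f + x) ` F \<longleftrightarrow> f - x \<in> F" for f x :: "'a::group_add"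
  by (auto intro!: image_eqI[where x = "f - x"])

lemma prevalentE:
  assumes "prevalent (C_dim_top \<alpha>) F"
  obtains \<mu> K where "space \<mu> = topspace (C_dim_top \<alpha>)" "sets \<mu> = sets (borel_of_top (C_dim_top \<alpha>))"
    "compactin (C_dim_top \<alpha>) K" "K \<in> sets \<mu>" "0 < emeasure \<mu> K" "emeasure \<mu> K < \<infinity>"
    "\<And>x. x \<in> C_dim \<alpha> \<Longrightarrow> AE f in \<mu>. f - x \<in> F"
proof -
  obtain \<mu> K where *: "space \<mu> = topspace (C_dim_top \<alpha>)" "sets \<mu> = sets (borel_of_top (C_dim_top \<alpha>))"
    "compactin (C_dim_top \<alpha>) K" "0 < emeasure \<mu> K" "emeasure \<mu> K < \<infinity>"
    and null: "\<And>x. x \<in> C_dim \<alpha> \<Longrightarrow> C_dim \<alpha> - (\<lambda>f. f + x) ` F \<in> null_sets \<mu>"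
    using assms unfolding prevalent_def topspace_C_dim_top by blast
  \<comment> \<open>Positive \<open>emeasure\<close> implies measurability, since
    \<open>emeasure\<close> is 0 on non-measurable sets.\<close>
  have "K \<in> sets \<mu>" using *(4) by (intro emeasure_neq_0_sets) simp
  moreover have "AE f in \<mu>. f - x \<in> F" if "x \<in> C_dim \<alpha>" for x
    using AE_not_in[OF null[OF that]] AE_space
    by eventually_elim (auto simp: mem_translate_iff *(1) topspace_C_dim_top)
  ultimately show thesis using * by (intro that)
qed

lemma AE_positive_obtain:
  assumes "AE x in \<mu>. P x" "K \<in> sets \<mu>" "0 < emeasure \<mu> K"
  obtains x where "x \<in> K" "P x"
proof -
  have "\<exists>x\<in>K. P x"
  proof (rule ccontr)
    assume no: "\<not> ?thesis"
    have "AE x in \<mu>. x \<notin> K" using assms(1) by eventually_elim (use no in blast)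
    then have "K \<in> null_sets \<mu>" using assms(2) by (subst AE_iff_null_sets)
    then show False using assms(3) by (simp add: null_sets_def)
  qed
  then show thesis using that by blast
qed

lemma not_prevalent_U_dim:
  assumes "2 \<le> \<alpha>" shows "\<not> prevalent (C_dim_top \<alpha>) (U_dim \<alpha>)"
proof
  assume "prevalent (C_dim_top \<alpha>) (U_dim \<alpha>)"
  then obtain \<mu> K where \<mu>: "compactin (C_dim_top \<alpha>) K" "K \<in> sets \<mu>" "0 < emeasure \<mu> K"
    and ae: "\<And>x. x \<in> C_dim \<alpha> \<Longrightarrow> AE f in \<mu>. f - x \<in> U_dim \<alpha>"
    by (rule prevalentE) blast
  obtain p :: "real \<Rightarrow> real" and B where p: "continuous_on UNIV p" "mono p" "\<And>y. y \<le> 0 \<Longrightarrow> p y = 0" "\<And>y. p y \<le> B"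
    "\<And>f t r s. f \<in> K \<Longrightarrow> t \<in> {0..1} \<Longrightarrow> r \<in> {0..1} \<Longrightarrow> s \<in> {0..1} \<Longrightarrow> \<bar>f (t, r) - f (t, s)\<bar> \<le> p \<bar>r - s\<bar>"
    using compactin_C_dim_vertical_modulus[OF \<mu>(1)] by blast
  define x1 where "x1 = zero_ext (ridge p 0)"
  \<comment> \<open>Prevalence yields \<open>f - x2\<close>, so \<open>bumps\<close> enters with a
    minus sign in order to be added to \<open>f\<close>.\<close>
  define x2 where "x2 = zero_ext (ridge p 0 - bumps)"
  note rb = rowwise_bounded_ridge[OF p(2,3,4), of 0]
  have "continuous_on unit_square (ridge p 0 - bumps)"
    unfolding fun_diff_def by (intro continuous_on_diff continuous_on_ridge p(1) continuous_on_bumps)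
  then have "x2 \<in> C_dim \<alpha>"
    unfolding x2_def using rowwise_bounded_diff[OF rb rowwise_bounded_bumps] assms by (rule zero_ext_in_C_dim)
  moreover have "x1 \<in> C_dim \<alpha>"
    unfolding x1_def using continuous_on_ridge[OF p(1)] rb assms by (rule zero_ext_in_C_dim)
  ultimately have "AE f in \<mu>. f - x1 \<in> U_dim \<alpha> \<and> f - x2 \<in> U_dim \<alpha>"
    using ae by (simp add: AE_conj_iff)
  then obtain f where f: "f \<in> K" "f - x1 \<in> U_dim \<alpha>" "f - x2 \<in> U_dim \<alpha>"
    using \<mu>(2,3) by (rule AE_positive_obtain) blast
  define \<phi> where "\<phi> t = f (t, 0)" for t
  have le: "f (t, y) - p \<bar>y\<bar> \<le> f (t, 0)" if "t \<in> {0..1}" "y \<in> {0..1}" for t y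
    using p(5)[OF f(1) that(1,2), of 0] by simp
  have "graph_on {0..1} (horizon (f - x1)) = graph_on {0..1} (\<lambda>t. (f - x1) (t, 0))"
    by (rule graph_on_horizon_eq) (use le p(3) in \<open>auto simp: x1_def zero_ext_def ridge_def\<close>)
  also have "\<dots> = graph_on {0..1} \<phi>"
    unfolding graph_on_def by (rule image_cong) (use p(3) in \<open>auto simp: x1_def zero_ext_def ridge_def \<phi>_def\<close>)
  finally have 1: "upper_box_dim (graph_on {0..1} \<phi>) < 2" using f(2) by (simp add: U_dim_def)
  \<comment> \<open>Two effects agree on the line \<open>y = 0\<close>: the ridge outweighs the
    variation of \<open>f\<close>, and \<open>bumps\<close> is itself largest there.\<close>
  have le2: "f (t, y) - (p \<bar>y\<bar> - bumps (t, y)) \<le> f (t, 0) + bumps (t, 0)" if "t \<in> {0..1}" "y \<in> {0..1}" for t y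
    using le[OF that] bumps_le_base[of y t] that(2) by simp
  have "graph_on {0..1} (horizon (f - x2)) = graph_on {0..1} (\<lambda>t. (f - x2) (t, 0))"
    by (rule graph_on_horizon_eq) (use le2 p(3) in \<open>auto simp: x2_def zero_ext_def ridge_def\<close>)
  also have "\<dots> = graph_on {0..1} (\<lambda>t. \<phi> t + bumps (t, 0))"
    unfolding graph_on_def by (rule image_cong) (use p(3) in \<open>auto simp: x2_def zero_ext_def ridge_def \<phi>_def\<close>)
  finally have 2: "upper_box_dim (graph_on {0..1} (\<lambda>t. \<phi> t + bumps (t, 0))) < 2"
    using f(3) by (simp add: U_dim_def)
  have "continuous_on unit_square f"
    using compactin_C_dim_subset[OF \<mu>(1)] f(1) by (auto intro: C_dim_continuous)
  then have "continuous_on {0..1} \<phi>"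
    unfolding \<phi>_def by (rule continuous_on_compose2) (auto intro!: continuous_intros)
  from upper_box_dim_add_bumps[OF this 1] 2 show False by contradiction
qed

lemma not_prevalent_L_dim:
  assumes "2 \<le> \<alpha>" shows "\<not> prevalent (C_dim_top \<alpha>) (L_dim \<alpha>)"
proof
  assume "prevalent (C_dim_top \<alpha>) (L_dim \<alpha>)"
  then obtain \<mu> K where \<mu>: "space \<mu> = topspace (C_dim_top \<alpha>)" "sets \<mu> = sets (borel_of_top (C_dim_top \<alpha>))"
    "compactin (C_dim_top \<alpha>) K" "K \<in> sets \<mu>" "0 < emeasure \<mu> K" "emeasure \<mu> K < \<infinity>"
    and ae: "\<And>x. x \<in> C_dim \<alpha> \<Longrightarrow> AE f in \<mu>. f - x \<in> L_dim \<alpha>"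
    by (rule prevalentE) blast
  obtain p :: "real \<Rightarrow> real" and B where p: "continuous_on UNIV p" "mono p" "\<And>y. y \<le> 0 \<Longrightarrow> p y = 0" "\<And>y. p y \<le> B"
    "\<And>f t r s. f \<in> K \<Longrightarrow> t \<in> {0..1} \<Longrightarrow> r \<in> {0..1} \<Longrightarrow> s \<in> {0..1} \<Longrightarrow> \<bar>f (t, r) - f (t, s)\<bar> \<le> p \<bar>r - s\<bar>"
    using compactin_C_dim_vertical_modulus[OF \<mu>(3)] by blast
  obtain y where y: "y \<in> {0..1}"
    and low: "AE f in \<mu>. f \<in> K \<longrightarrow> lower_box_dim (graph_on {0..1} (\<lambda>t. f (t, y))) \<le> ereal (\<alpha> - 1)"
    using AE_trace_lower_box_dim[OF \<mu>(1-4,6) assms] by blast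
  define x where "x = zero_ext (ridge p y)"
  have "x \<in> C_dim \<alpha>"
    unfolding x_def using continuous_on_ridge[OF p(1)] rowwise_bounded_ridge[OF p(2,3,4)] assms
    by (rule zero_ext_in_C_dim)
  with low ae have "AE f in \<mu>. f - x \<in> L_dim \<alpha> \<and>
      (f \<in> K \<longrightarrow> lower_box_dim (graph_on {0..1} (\<lambda>t. f (t, y))) \<le> ereal (\<alpha> - 1))"
    by (simp add: AE_conj_iff)
  then obtain f where f: "f \<in> K" "f - x \<in> L_dim \<alpha>"
      "lower_box_dim (graph_on {0..1} (\<lambda>t. f (t, y))) \<le> ereal (\<alpha> - 1)"
    using \<mu>(4,5) by (rule AE_positive_obtain) blast
  have le: "f (t, s) - p \<bar>s - y\<bar> \<le> f (t, y)" if "t \<in> {0..1}" "s \<in> {0..1}" for t s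
    using p(5)[OF f(1) that y] by simp
  have "graph_on {0..1} (horizon (f - x)) = graph_on {0..1} (\<lambda>t. (f - x) (t, y))"
    by (rule graph_on_horizon_eq[OF y]) (use le p(3) y in \<open>auto simp: x_def zero_ext_def ridge_def\<close>)
  also have "\<dots> = graph_on {0..1} (\<lambda>t. f (t, y))"
    unfolding graph_on_def by (rule image_cong) (use p(3) y in \<open>auto simp: x_def zero_ext_def ridge_def\<close>)
  finally show False using f(2,3) by (auto simp: L_dim_def)
qed

theorem theorem1p7:
  fixes \<alpha> :: real
  assumes "2 \<le> \<alpha>" and "\<alpha> < 3"
  shows "\<not> prevalent (C_dim_top \<alpha>) (U_dim \<alpha>) \<and> \<not> prevalent (C_dim_top \<alpha>) (L_dim \<alpha>)"
  using not_prevalent_U_dim[OF assms(1)] not_prevalent_L_dim[OF assms(1)] by blast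

end
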